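(* As formal power series, \[ A_{\{1,4\}}(x,y) = \frac{1-x^{2}-x^{4}-x^{3}y+x^{6}}{(1-xy-x^4y^4)(1-x^{2}-x^{4} - x^{3}y+x^{6})-2x^4y(x+y-x^3)}, \] and for any integer $c \geq 1$, $A_{\{c,4c\}}(x,y) = A_{\{1,4\}}(x^c,y^c)$.
   Context: A composition of $n$ is an ordered list of positive integers (parts) with sum $n$; the empty list is the unique composition of $0$. A meander on $n$ nodes is a pair $\frac{\lambda}{\mu}$ of compositions of $n$, viewed as a planar (multi)graph on vertices $1,\dots,n$: for each part $a$ of $\lambda$, occupying the consecutive vertices $p+1,\dots,p+a$ (where $p$ is the sum of the preceding parts), there is an upper edge joining $p+i$ and $p+a+1-i$ for each $1\le i\le \lfloor a/2\rfloor$; lower edges are defined in the same way from $\mu$. If the same two vertices are joined by both an upper and a lower edge, both edges are kept and form a cycle. Every connected component is a cycle or a path (an isolated vertex counts as a path). The index is $\operatorname{ind}(\frac{\lambda}{\mu}) = 2c+p$, where here $c$ is the number of cycles and $p$ is the number of paths (this equals the index of the associated seaweed subalgebra of $\mathfrak{gl}_n$). For a set $J$ of positive integers, $a^J_{n,k}$ is the number of meanders $\frac{\lambda}{\mu}$ on $n$ nodes of index $k$ such that all parts of $\lambda$ and $\mu$ lie in $J$, and $A_J(x,y)=\sum_{n,k\ge 0} a^J_{n,k}x^ny^k$ (the empty meander gives $a^J_{0,0}=1$). *)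

theory Defs
  imports "HOL-Computational_Algebra.Computational_Algebra"
begin

section \<open>Finite multigraphs\<close>

text \<open>
  A multigraph is given by a vertex set \<open>V\<close> and a set \<open>E\<close> of labelled edges; the edge
  \<open>(l, {u, v})\<close> joins \<open>u\<close> and \<open>v\<close>, and the label \<open>l\<close> keeps parallel edges apart.
\<close>

type_synonym ('l, 'v) ledge = "'l \<times> 'v set"

definition components :: "'v set \<Rightarrow> ('l, 'v) ledge set \<Rightarrow> 'v set set" where
  "components V E =
     V // {(u, v). u \<in> V \<and> v \<in> V \<and> (u, v) \<in> {(a, b). \<exists>l. (l, {a, b}) \<in> E}\<^sup>*}"

definition edges_within :: "('l, 'v) ledge set \<Rightarrow> 'v set \<Rightarrow> ('l, 'v) ledge set" where
  "edges_within E C = {e \<in> E. snd e \<subseteq> C}"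

text \<open>A cycle may have length 2, consisting of two parallel edges.\<close>

definition is_cycle :: "'v set \<Rightarrow> ('l, 'v) ledge set \<Rightarrow> bool" where
  "is_cycle V E \<longleftrightarrow>
     (\<exists>vs es. vs \<noteq> [] \<and> distinct vs \<and> set vs = V \<and> distinct es \<and> set es = E \<and>
        length es = length vs \<and>
        (\<forall>i < length vs. snd (es ! i) = {vs ! i, vs ! (Suc i mod length vs)}))"

text \<open>A single vertex without edges is a path.\<close>

definition is_path :: "'v set \<Rightarrow> ('l, 'v) ledge set \<Rightarrow> bool" where
  "is_path V E \<longleftrightarrow>
     (\<exists>vs es. distinct vs \<and> set vs = V \<and> distinct es \<and> set es = E \<and>
        length vs = Suc (length es) \<and>
        (\<forall>i < length es. snd (es ! i) = {vs ! i, vs ! Suc i}))"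

section \<open>Meanders\<close>

definition is_composition :: "nat \<Rightarrow> nat list \<Rightarrow> bool" where
  "is_composition n c \<longleftrightarrow> (\<forall>a \<in> set c. 0 < a) \<and> sum_list c = n"

text \<open>The edge sets of the arcs nested over each block of consecutive vertices.\<close>

definition arcs :: "nat list \<Rightarrow> nat set set" where
  "arcs c = {{p + i, p + a + 1 - i} | j p a i.
     j < length c \<and> p = sum_list (take j c) \<and> a = c ! j \<and> 1 \<le> i \<and> i \<le> a div 2}"

datatype side = Upper | Lower

definition meander_edges :: "nat list \<Rightarrow> nat list \<Rightarrow> (side, nat) ledge set" where
  "meander_edges us ls = {Upper} \<times> arcs us \<union> {Lower} \<times> arcs ls"

definition is_meander :: "nat \<Rightarrow> nat list \<times> nat list \<Rightarrow> bool" where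
  "is_meander n M \<longleftrightarrow> is_composition n (fst M) \<and> is_composition n (snd M)"

definition meander_components :: "nat list \<times> nat list \<Rightarrow> nat set set" where
  "meander_components M =
     components {1..sum_list (fst M)} (meander_edges (fst M) (snd M))"

definition num_cycles :: "nat list \<times> nat list \<Rightarrow> nat" where
  "num_cycles M = card {C \<in> meander_components M.
     is_cycle C (edges_within (meander_edges (fst M) (snd M)) C)}"

definition num_paths :: "nat list \<times> nat list \<Rightarrow> nat" where
  "num_paths M = card {C \<in> meander_components M.
     is_path C (edges_within (meander_edges (fst M) (snd M)) C)}"

definition ind :: "nat list \<times> nat list \<Rightarrow> nat" where
  "ind M = 2 * num_cycles M + num_paths M"

definition meander_count :: "nat set \<Rightarrow> nat \<Rightarrow> nat \<Rightarrow> nat" where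
  "meander_count J n k =
     card {M. is_meander n M \<and> set (fst M) \<subseteq> J \<and> set (snd M) \<subseteq> J \<and> ind M = k}"

section \<open>Bivariate generating functions\<close>

text \<open>
  A power series in \<open>x\<close> and \<open>y\<close> is a power series in \<open>x\<close> whose coefficients are power series
  in \<open>y\<close>: the coefficient of \<open>x\<^sup>n y\<^sup>k\<close> in \<open>F\<close> is \<open>F $ n $ k\<close>.
\<close>

abbreviation varx :: "rat fps fps" where "varx \<equiv> fps_X"
abbreviation vary :: "rat fps fps" where "vary \<equiv> fps_const fps_X"

definition meander_gf :: "nat set \<Rightarrow> rat fps fps" where
  "meander_gf J = Abs_fps (\<lambda>n. Abs_fps (\<lambda>k. of_nat (meander_count J n k)))"

text \<open>
  The substitution \<open>F(x\<^sup>c, y\<^sup>c)\<close>. As always with \<open>fps_compose\<close>, this is only meaningful if the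
  substituted series have constant term 0, that is for \<open>c \<ge> 1\<close>.
\<close>

definition subst_powers :: "nat \<Rightarrow> rat fps fps \<Rightarrow> rat fps fps" where
  "subst_powers c F = fps_compose (Abs_fps (\<lambda>n. fps_compose (F $ n) (fps_X ^ c))) (fps_X ^ c)"

text \<open>
  The coefficient ring \<open>rat fps\<close> is not a field, but division of bivariate series is the genuine
  quotient whenever the denominator has \<open>x\<close>-constant term 1.
\<close>

lemma fps2_divide_eq_iff:
  fixes F G H :: "rat fps fps"
  assumes "G $ 0 = 1"
  shows "F / G = H \<longleftrightarrow> F = H * G"
proof -
  have "subdegree G = 0"
    using assms by (simp add: subdegree_eq_0_iff)
  then have div: "F / G = F * inverse G"
    by (rule fps_divide_unit')
  have unit: "G * inverse G = 1"
    using assms fps_right_inverse[of G 1] fps_right_inverse[of "1 :: rat fps" 1] by (simp add: fps_inverse_def)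
  show ?thesis
  proof
    assume "F / G = H"
    then have "H * G = F * (G * inverse G)"
      unfolding div by (auto simp: mult_ac)
    then show "F = H * G"
      unfolding unit by simp
  next
    assume "F = H * G"
    then have "F / G = H * (G * inverse G)"
      unfolding div by (simp only: mult.assoc)
    then show "F / G = H"
      unfolding unit by simp
  qed
qed

end

theory Submission
  imports Defs
begin

text \<open>
  The arcs over each composition are the 2-cycles of an involution on the vertices, so the components
  of a meander are the orbits of two involutions: such an orbit is a path if one of the involutions
  has a fixed point in it, and a cycle otherwise. Contracting the first upper block along the lower
  arcs preserves the orbits and yields, for \<open>2 * a \<le> b\<close>, Panyushev's reduction
  \<open>ind (a # us, b # ls) = ind (us, (b - 2 * a) # a # ls)\<close>, while \<open>ind (a # us, a # ls) = a + ind (us, ls)\<close>.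

  With all parts in \<open>{1, 4}\<close>, these two rules lead only to meanders whose upper composition is
  prefixed by \<open>[]\<close>, \<open>[1]\<close>, \<open>[1, 1]\<close> or \<open>[2, 1]\<close> (up to exchanging the sides), and the generating
  functions of these four states satisfy a linear system whose solution is the stated fraction. The
  same rules with all parts multiplied by \<open>c\<close> show that scaling multiplies the index by \<open>c\<close>.
\<close>

section \<open>Orbits of two involutions\<close>

definition orb :: "('a \<Rightarrow> 'a) \<Rightarrow> ('a \<Rightarrow> 'a) \<Rightarrow> 'a \<Rightarrow> 'a set" where
  "orb f g v = {w. (v, w) \<in> {(a, b). b = f a \<or> b = g a}\<^sup>*}"

text \<open>The maps are total functions but are constrained only on the finite set
  \<open>V\<close>, where \<open>orb\<close> has to stay; their values elsewhere are
  arbitrary.\<close>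

definition involutions :: "'a set \<Rightarrow> ('a \<Rightarrow> 'a) \<Rightarrow> ('a \<Rightarrow> 'a) \<Rightarrow> bool" where
  "involutions V f g \<longleftrightarrow>
     finite V \<and> (\<forall>v\<in>V. f v \<in> V \<and> g v \<in> V \<and> f (f v) = v \<and> g (g v) = v)"

definition has_fixpoint :: "('a \<Rightarrow> 'a) \<Rightarrow> ('a \<Rightarrow> 'a) \<Rightarrow> 'a set \<Rightarrow> bool" where
  "has_fixpoint f g C \<longleftrightarrow> (\<exists>v\<in>C. f v = v \<or> g v = v)"

definition orbit_index :: "'a set \<Rightarrow> ('a \<Rightarrow> 'a) \<Rightarrow> ('a \<Rightarrow> 'a) \<Rightarrow> nat" where
  "orbit_index V f g = (\<Sum>C\<in>orb f g ` V. if has_fixpoint f g C then 1 else 2)"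

lemma orb_self [simp]: "v \<in> orb f g v"
  by (simp add: orb_def)

lemma orb_step:
  assumes "w \<in> orb f g v"
  shows "f w \<in> orb f g v" "g w \<in> orb f g v"
  using assms unfolding orb_def mem_Collect_eq by (rule rtrancl_into_rtrancl; simp)+

lemma orb_least:
  assumes "v \<in> S" "\<And>x. x \<in> S \<Longrightarrow> f x \<in> S" "\<And>x. x \<in> S \<Longrightarrow> g x \<in> S"
  shows "orb f g v \<subseteq> S"
proof
  fix w assume "w \<in> orb f g v"
  then have "(v, w) \<in> {(a, b). b = f a \<or> b = g a}\<^sup>*" by (simp add: orb_def)
  then show "w \<in> S" by induction (use assms in auto)
qed

lemma orb_trans: "w \<in> orb f g v \<Longrightarrow> u \<in> orb f g w \<Longrightarrow> u \<in> orb f g v"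
  unfolding orb_def mem_Collect_eq by (rule rtrancl_trans)

lemma orb_commute: "orb f g = orb g f"
  unfolding orb_def by (simp add: disj_commute)

lemma has_fixpoint_commute: "has_fixpoint f g C = has_fixpoint g f C"
  unfolding has_fixpoint_def by blast

lemma involutions_commute: "involutions V f g \<longleftrightarrow> involutions V g f"
  unfolding involutions_def by blast

lemma orbit_index_commute: "orbit_index V f g = orbit_index V g f"
  unfolding orbit_index_def by (simp add: orb_commute[of f g] has_fixpoint_commute[of f g])

lemma involutionsD:
  assumes "involutions V f g" "v \<in> V"
  shows "f v \<in> V" "g v \<in> V" "f (f v) = v" "g (g v) = v"
  using assms by (auto simp: involutions_def)

lemma orb_subset:
  assumes "involutions V f g" "v \<in> V"
  shows "orb f g v \<subseteq> V"
  by (rule orb_least) (use assms in \<open>auto simp: involutions_def\<close>)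

text \<open>The closure in \<open>orb\<close> is directed. A step is undone by the map that made it,
  which is known only inside \<open>V\<close>, so the induction also carries
  \<open>w \<in> V\<close>.\<close>

lemma orb_sym:
  assumes inv: "involutions V f g" and v: "v \<in> V" and w: "w \<in> orb f g v"
  shows "v \<in> orb f g w"
proof -
  have "(v, w) \<in> {(a, b). b = f a \<or> b = g a}\<^sup>*" using w by (simp add: orb_def)
  then have "w \<in> V \<and> v \<in> orb f g w"
  proof induction
    case base
    then show ?case using v by simp
  next
    case (step y z)
    then have y: "y \<in> V" and vy: "v \<in> orb f g y" and z: "z = f y \<or> z = g y" by auto
    have "y \<in> orb f g z"
      using z involutionsD(3,4)[OF inv y] orb_step[OF orb_self[of z f g]] by auto
    then show ?case
      using orb_trans[OF _ vy] z involutionsD(1,2)[OF inv y] by auto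
  qed
  then show ?thesis by simp
qed

lemma orb_eq:
  assumes "involutions V f g" "v \<in> V" "w \<in> orb f g v"
  shows "orb f g w = orb f g v"
  using orb_trans[OF assms(3)] orb_trans[OF orb_sym[OF assms]] by (intro equalityI subsetI)

lemma orb_cong:
  assumes inv: "involutions V f g" and v: "v \<in> V"
    and eq: "\<And>x. x \<in> V \<Longrightarrow> f' x = f x" "\<And>x. x \<in> V \<Longrightarrow> g' x = g x"
  shows "orb f' g' v = orb f g v"
proof
  have inv': "involutions V f' g'"
    using inv eq by (auto simp: involutions_def)
  have *: "\<And>x. x \<in> orb f g v \<Longrightarrow> f' x = f x \<and> g' x = g x"
    using orb_subset[OF inv v] eq by auto
  show "orb f' g' v \<subseteq> orb f g v"
    by (rule orb_least) (use * orb_step[of _ f g v] in auto)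
  have *: "\<And>x. x \<in> orb f' g' v \<Longrightarrow> f' x = f x \<and> g' x = g x"
    using orb_subset[OF inv' v] eq by auto
  show "orb f g v \<subseteq> orb f' g' v"
    by (rule orb_least) (use * orb_step[of _ f' g' v] in force)+
qed

section \<open>Computing and comparing orbit indices\<close>

lemma orbit_index_cong:
  assumes inv: "involutions V f g"
    and eq: "\<And>x. x \<in> V \<Longrightarrow> f' x = f x" "\<And>x. x \<in> V \<Longrightarrow> g' x = g x"
  shows "orbit_index V f' g' = orbit_index V f g"
proof -
  have "orb f' g' ` V = orb f g ` V"
    using orb_cong[OF inv _ eq] by (intro image_cong) auto
  moreover have "has_fixpoint f' g' C = has_fixpoint f g C" if "C \<in> orb f g ` V" for C
  proof -
    have "C \<subseteq> V" using that orb_subset[OF inv] by auto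
    then have "\<And>x. x \<in> C \<Longrightarrow> f' x = f x \<and> g' x = g x" using eq by auto
    then show ?thesis unfolding has_fixpoint_def by simp
  qed
  ultimately show ?thesis unfolding orbit_index_def by (intro sum.cong) auto
qed

text \<open>Both pieces are closed under the two maps, so no orbit meets both and the sum over
  orbits splits.\<close>

lemma orbit_index_union:
  assumes "involutions V f g" "involutions W f g" "V \<inter> W = {}"
  shows "orbit_index (V \<union> W) f g = orbit_index V f g + orbit_index W f g"
  unfolding orbit_index_def image_Un
proof (rule sum.union_disjoint)
  show "orb f g ` V \<inter> orb f g ` W = {}"
  proof (rule ccontr)
    assume "orb f g ` V \<inter> orb f g ` W \<noteq> {}"
    then obtain v w where "v \<in> V" "w \<in> W" "orb f g v = orb f g w" by auto
    then have "v \<in> W" using orb_subset[OF assms(2)] orb_self[of v f g] by auto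
    then show False using \<open>v \<in> V\<close> assms(3) by auto
  qed
qed (use assms in \<open>auto simp: involutions_def\<close>)

text \<open>Each orbit is \<open>{v, f v}\<close>: a singleton of weight 1 if \<open>v\<close> is
  fixed, otherwise a pair of weight 2. Weight thus equals cardinality, and the orbits partition
  \<open>V\<close>.\<close>

lemma orbit_index_same:
  assumes inv: "involutions V f f"
  shows "orbit_index V f f = card V"
proof -
  have fin: "finite V" using inv by (simp add: involutions_def)
  have orb: "orb f f v = {v, f v}" if "v \<in> V" for v
  proof
    show "orb f f v \<subseteq> {v, f v}"
      by (rule orb_least) (use involutionsD[OF inv that] in auto)
    show "{v, f v} \<subseteq> orb f f v"
      using orb_step[OF orb_self[of v f f]] by auto
  qed
  have "orbit_index V f f = (\<Sum>C\<in>orb f f ` V. card C)"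
    unfolding orbit_index_def
  proof (rule sum.cong)
    fix C assume "C \<in> orb f f ` V"
    then obtain v where v: "v \<in> V" "C = {v, f v}" using orb by auto
    then have "has_fixpoint f f C \<longleftrightarrow> f v = v"
      unfolding has_fixpoint_def using involutionsD[OF inv v(1)] by auto
    then show "(if has_fixpoint f f C then 1 else 2) = card C"
      using v(2) by auto
  qed simp
  also have "\<dots> = card (\<Union>(orb f f ` V))"
  proof (rule card_Union_disjoint[symmetric])
    show "pairwise disjnt (orb f f ` V)"
    proof (rule pairwiseI)
      fix C D assume "C \<in> orb f f ` V" "D \<in> orb f f ` V" "C \<noteq> D"
      then obtain v w where *: "v \<in> V" "C = orb f f v" "w \<in> V" "D = orb f f w" by auto
      show "disjnt C D"
        unfolding disjnt_def using \<open>C \<noteq> D\<close> * orb_eq[OF inv] by blast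
    qed
    show "\<And>A. A \<in> orb f f ` V \<Longrightarrow> finite A" using orb by auto
  qed
  also have "\<Union>(orb f f ` V) = V"
    using orb_subset[OF inv] by force
  finally show ?thesis .
qed

text \<open>The maps \<open>r\<close> and \<open>s\<close> need not be inverse bijections:
  \<open>s (r v)\<close> only has to lie in the orbit of \<open>v\<close>, so \<open>r\<close> may
  merge vertices of one orbit. Both maps send orbits into orbits, hence induce mutually inverse maps
  between the two sets of orbits, and the last two assumptions make the weights agree.\<close>

lemma orbit_index_transfer:
  assumes inv: "involutions V f g" and inv': "involutions V' f' g'"
    and r: "\<And>v. v \<in> V \<Longrightarrow> r v \<in> V'" and s: "\<And>v. v \<in> V' \<Longrightarrow> s v \<in> V"
    and rs: "\<And>v. v \<in> V' \<Longrightarrow> r (s v) = v"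
    and sr: "\<And>v. v \<in> V \<Longrightarrow> s (r v) \<in> orb f g v"
    and rf: "\<And>v. v \<in> V \<Longrightarrow> r (f v) \<in> orb f' g' (r v)"
    and rg: "\<And>v. v \<in> V \<Longrightarrow> r (g v) \<in> orb f' g' (r v)"
    and sf: "\<And>v. v \<in> V' \<Longrightarrow> s (f' v) \<in> orb f g (s v)"
    and sg: "\<And>v. v \<in> V' \<Longrightarrow> s (g' v) \<in> orb f g (s v)"
    and rfix: "\<And>v. v \<in> V \<Longrightarrow> f v = v \<or> g v = v \<Longrightarrow> has_fixpoint f' g' (orb f' g' (r v))"
    and sfix: "\<And>v. v \<in> V' \<Longrightarrow> f' v = v \<or> g' v = v \<Longrightarrow> has_fixpoint f g (orb f g (s v))"
  shows "orbit_index V f g = orbit_index V' f' g'"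
proof -
  have r_orb: "r w \<in> orb f' g' (r v)" if v: "v \<in> V" and w: "w \<in> orb f g v" for v w
  proof -
    have "orb f g v \<subseteq> {w \<in> V. r w \<in> orb f' g' (r v)}"
      by (rule orb_least)
         (use v involutionsD[OF inv] orb_trans[OF _ rf] orb_trans[OF _ rg] in auto)
    then show ?thesis using w by auto
  qed
  have s_orb: "s w \<in> orb f g (s v)" if v: "v \<in> V'" and w: "w \<in> orb f' g' v" for v w
  proof -
    have "orb f' g' v \<subseteq> {w \<in> V'. s w \<in> orb f g (s v)}"
      by (rule orb_least)
         (use v involutionsD[OF inv'] orb_trans[OF _ sf] orb_trans[OF _ sg] in auto)
    then show ?thesis using w by auto
  qed
  have s_eq: "orb f g (s v) = orb f g (s w)" if "v \<in> V'" "w \<in> V'" "orb f' g' v = orb f' g' w" for v w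
    by (metis orb_eq[OF inv s s_orb] that orb_self)
  have fix_eq: "has_fixpoint f g (orb f g (s v)) = has_fixpoint f' g' (orb f' g' v)"
    if v: "v \<in> V'" for v
  proof
    assume "has_fixpoint f g (orb f g (s v))"
    then obtain w where w: "w \<in> orb f g (s v)" "f w = w \<or> g w = w"
      by (auto simp: has_fixpoint_def)
    have "w \<in> V" using orb_subset[OF inv s[OF v]] w by auto
    moreover have "orb f' g' (r w) = orb f' g' v"
      using orb_eq[OF inv' v, of "r w"] r_orb[OF s[OF v] w(1)] unfolding rs[OF v] by blast
    ultimately show "has_fixpoint f' g' (orb f' g' v)" using rfix w by metis
  next
    assume "has_fixpoint f' g' (orb f' g' v)"
    then obtain w where w: "w \<in> orb f' g' v" "f' w = w \<or> g' w = w"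
      by (auto simp: has_fixpoint_def)
    have "w \<in> V'" using orb_subset[OF inv' v] w by auto
    moreover have "orb f g (s w) = orb f g (s v)"
      by (rule orb_eq[OF inv s[OF v] s_orb[OF v w(1)]])
    ultimately show "has_fixpoint f g (orb f g (s v))" using sfix w by metis
  qed
  \<comment> \<open>On an orbit, \<open>h\<close> yields a singleton set of orbits;
    \<open>the_elem\<close> then gives the induced map on orbits without choosing
    representatives.\<close>
  define h where "h C = orb f' g' ` r ` C" for C
  have h: "h (orb f g v) = {orb f' g' (r v)}" if v: "v \<in> V" for v
  proof -
    have *: "orb f' g' (r w) = orb f' g' (r v)" if "w \<in> orb f g v" for w
      by (rule orb_eq[OF inv' r[OF v] r_orb[OF v that]])
    have "h (orb f g v) = (\<lambda>_. orb f' g' (r v)) ` orb f g v"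
      unfolding h_def image_image by (rule image_cong[OF refl *])
    then show ?thesis using orb_self[of v f g] by blast
  qed
  have img: "orb f g ` V = (\<lambda>v. orb f g (s v)) ` V'"
  proof
    show "orb f g ` V \<subseteq> (\<lambda>v. orb f g (s v)) ` V'"
    proof
      fix C assume "C \<in> orb f g ` V"
      then obtain v where v: "v \<in> V" "C = orb f g v" by blast
      then have "C = orb f g (s (r v))" using orb_eq[OF inv v(1) sr[OF v(1)]] by metis
      then show "C \<in> (\<lambda>v. orb f g (s v)) ` V'" using r[OF v(1)] by blast
    qed
    show "(\<lambda>v. orb f g (s v)) ` V' \<subseteq> orb f g ` V" using s by auto
  qed
  have h_s: "the_elem (h (orb f g (s v))) = orb f' g' v" if "v \<in> V'" for v
    unfolding h[OF s[OF that]] rs[OF that] by simp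
  have "bij_betw (\<lambda>C. the_elem (h C)) (orb f g ` V) (orb f' g' ` V')"
    unfolding bij_betw_def
  proof
    show "inj_on (\<lambda>C. the_elem (h C)) (orb f g ` V)"
    proof (rule inj_onI)
      fix C D assume CD: "C \<in> orb f g ` V" "D \<in> orb f g ` V" and eq: "the_elem (h C) = the_elem (h D)"
      obtain v w where vw: "v \<in> V'" "C = orb f g (s v)" "w \<in> V'" "D = orb f g (s w)"
        using CD unfolding img by blast
      have "orb f' g' v = orb f' g' w"
        using eq unfolding vw(2,4) h_s[OF vw(1)] h_s[OF vw(3)] .
      then show "C = D" unfolding vw(2,4) by (rule s_eq[OF vw(1,3)])
    qed
    show "(\<lambda>C. the_elem (h C)) ` orb f g ` V = orb f' g' ` V'"
      unfolding img image_image by (rule image_cong[OF refl h_s])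
  qed
  then have "orbit_index V' f' g' =
      (\<Sum>C\<in>orb f g ` V. if has_fixpoint f' g' (the_elem (h C)) then 1 else 2)"
    unfolding orbit_index_def by (rule sum.reindex_bij_betw[symmetric])
  also have "\<dots> = orbit_index V f g"
    unfolding orbit_index_def
  proof (rule sum.cong)
    fix C assume "C \<in> orb f g ` V"
    then obtain v where v: "v \<in> V'" "C = orb f g (s v)" using img by blast
    show "(if has_fixpoint f' g' (the_elem (h C)) then 1 else 2)
        = (if has_fixpoint f g C then 1 else (2::nat))"
      unfolding v(2) h_s[OF v(1)] fix_eq[OF v(1)] ..
  qed simp
  finally show ?thesis by simp
qed

section \<open>Cycles and paths as orbits\<close>

definition matching :: "'a set \<Rightarrow> ('a \<Rightarrow> 'a) \<Rightarrow> 'a set set" where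
  "matching V f = {{v, f v} | v. v \<in> V \<and> f v \<noteq> v}"

text \<open>With distinct labels, vertices exchanged by both maps carry two parallel edges, as a
  cycle of length 2 requires.\<close>

definition alt_edges :: "'l \<Rightarrow> 'l \<Rightarrow> 'a set \<Rightarrow> ('a \<Rightarrow> 'a) \<Rightarrow> ('a \<Rightarrow> 'a) \<Rightarrow> ('l, 'a) ledge set" where
  "alt_edges l m V f g = {l} \<times> matching V f \<union> {m} \<times> matching V g"

lemma alt_edges_commute: "alt_edges l m V f g = alt_edges m l V g f"
  unfolding alt_edges_def by (rule Un_commute)

text \<open>Edges and orbit steps differ only by the trivial steps at fixed points, which
  reflexivity of the closure absorbs, and by steps outside \<open>V\<close>, which are never reached
  from \<open>V\<close>.\<close>

lemma components_alt_edges: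
  assumes inv: "involutions V f g"
  shows "components V (alt_edges l m V f g) = orb f g ` V"
proof -
  define R where "R = {(a, b). \<exists>k. (k, {a, b}) \<in> alt_edges l m V f g}"
  have R_iff: "(a, b) \<in> R \<longleftrightarrow> a \<in> V \<and> b \<noteq> a \<and> (b = f a \<or> b = g a)" for a b
  proof
    assume "(a, b) \<in> R"
    then show "a \<in> V \<and> b \<noteq> a \<and> (b = f a \<or> b = g a)"
      unfolding R_def alt_edges_def matching_def
      using inv by (auto simp: doubleton_eq_iff involutions_def)
  next
    assume "a \<in> V \<and> b \<noteq> a \<and> (b = f a \<or> b = g a)"
    then show "(a, b) \<in> R"
      unfolding R_def alt_edges_def matching_def by blast
  qed
  have "{(u, v). u \<in> V \<and> v \<in> V \<and> (u, v) \<in> R\<^sup>*} `` {u} = orb f g u" if u: "u \<in> V" for u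
  proof
    show "{(u, v). u \<in> V \<and> v \<in> V \<and> (u, v) \<in> R\<^sup>*} `` {u} \<subseteq> orb f g u"
    proof -
      have "R \<subseteq> {(a, b). b = f a \<or> b = g a}" using R_iff by auto
      then have "R\<^sup>* \<subseteq> {(a, b). b = f a \<or> b = g a}\<^sup>*" by (rule rtrancl_mono)
      then show ?thesis unfolding orb_def by blast
    qed
    have "orb f g u \<subseteq> {v \<in> V. (u, v) \<in> R\<^sup>*}"
    proof (rule orb_least)
      fix x assume x: "x \<in> {v \<in> V. (u, v) \<in> R\<^sup>*}"
      have "(u, y) \<in> R\<^sup>*" if "y = f x \<or> y = g x" for y
      proof (cases "y = x")
        case False
        then have "(x, y) \<in> R" using that x unfolding R_iff by blast
        then show ?thesis using x by (blast intro: rtrancl_into_rtrancl)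
      qed (use x in simp)
      then show "f x \<in> {v \<in> V. (u, v) \<in> R\<^sup>*}" "g x \<in> {v \<in> V. (u, v) \<in> R\<^sup>*}"
        using x involutionsD(1,2)[OF inv] by blast+
    qed (use u in simp)
    then show "orb f g u \<subseteq> {(u, v). u \<in> V \<and> v \<in> V \<and> (u, v) \<in> R\<^sup>*} `` {u}"
      using u by auto
  qed
  then show ?thesis
    unfolding components_def R_def[symmetric] quotient_def by auto
qed

section \<open>Alternating walks along the two involutions\<close>

primrec walk :: "('a \<Rightarrow> 'a) \<Rightarrow> ('a \<Rightarrow> 'a) \<Rightarrow> 'a \<Rightarrow> nat \<Rightarrow> 'a" where
  "walk f g v 0 = v"
| "walk f g v (Suc i) = (if even i then f else g) (walk f g v i)"

lemma walk_in_orb: "walk f g v i \<in> orb f g v"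
  by (induction i) (simp_all add: orb_step)

context
  fixes V :: "'a set" and f g :: "'a \<Rightarrow> 'a" and v :: 'a
  assumes inv: "involutions V f g" and v: "v \<in> V"
begin

lemma walk_in: "walk f g v i \<in> V"
  using orb_subset[OF inv v] walk_in_orb[of f g v i] by auto

lemma walk_back: "walk f g v i = (if even i then f else g) (walk f g v (Suc i))"
  using involutionsD[OF inv walk_in[of i]] by auto

text \<open>
  Equal values at an odd distance force the walk between them to run through a vertex twice in a
  row: replaying it from both sides meets in the middle.
\<close>

lemma walk_fold:
  assumes "walk f g v i = walk f g v (i + Suc (2 * d))"
  shows "\<exists>k. i \<le> k \<and> k \<le> i + 2 * d \<and> walk f g v k = walk f g v (Suc k)"
  using assms
proof (induction d arbitrary: i)
  case 0
  then show ?case by (intro exI[of _ i]) (simp del: walk.simps)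
next
  case (Suc d)
  have "walk f g v (Suc i) = (if even i then f else g) (walk f g v (Suc (i + 2 * Suc d)))"
    using arg_cong[OF Suc.prems, of "if even i then f else g"] by simp
  also have "\<dots> = walk f g v (i + 2 * Suc d)"
    using walk_back[of "i + 2 * Suc d"] by (simp del: walk.simps)
  finally have "walk f g v (Suc i) = walk f g v (Suc i + Suc (2 * d))" by (simp del: walk.simps)
  from Suc.IH[OF this] obtain k where
    "Suc i \<le> k" "k \<le> Suc i + 2 * d" "walk f g v k = walk f g v (Suc k)" by blast
  then show ?case by (intro exI[of _ k]) (simp del: walk.simps)
qed

text \<open>At an even distance both values were reached by the same map, so undoing it moves the
  coincidence one step back, until the start is reached.\<close>

lemma walk_unshift:
  assumes "walk f g v i = walk f g v (i + 2 * d)"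
  shows "walk f g v 0 = walk f g v (2 * d)"
  using assms
proof (induction i)
  case (Suc i)
  have "walk f g v i = (if even i then f else g) (walk f g v (Suc (i + 2 * d)))"
    using Suc.prems walk_back[of i] by (simp del: walk.simps)
  also have "\<dots> = walk f g v (i + 2 * d)"
    using walk_back[of "i + 2 * d"] by (simp del: walk.simps)
  finally show ?case by (rule Suc.IH)
qed simp

lemma walk_repeats: "\<exists>i j. i < j \<and> walk f g v i = walk f g v j"
proof -
  have "\<not> inj (walk f g v)"
  proof
    assume "inj (walk f g v)"
    then have "infinite (range (walk f g v))" by (rule range_inj_infinite)
    moreover have "range (walk f g v) \<subseteq> V" using walk_in by auto
    ultimately show False using inv finite_subset by (auto simp: involutions_def)
  qed
  then show ?thesis unfolding inj_on_def by (metis nat_neq_iff)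
qed

text \<open>An orbit is closed under both maps, so it contains an edge as soon as it contains one
  endpoint. Edges of a component can therefore be indexed by its vertices.\<close>

lemma edge_in_orb_iff:
  "(k, e) \<in> edges_within (alt_edges l m V f g) (orb f g v) \<longleftrightarrow>
     (\<exists>w\<in>orb f g v. (k = l \<and> e = {w, f w} \<and> f w \<noteq> w) \<or> (k = m \<and> e = {w, g w} \<and> g w \<noteq> w))"
proof -
  have matching: "e \<in> matching V h \<and> e \<subseteq> orb f g v \<longleftrightarrow> (\<exists>w\<in>orb f g v. e = {w, h w} \<and> h w \<noteq> w)"
    if h: "\<And>w. w \<in> orb f g v \<Longrightarrow> h w \<in> orb f g v" for h
    using orb_subset[OF inv v] h unfolding matching_def by fastforce
  have "(k, e) \<in> edges_within (alt_edges l m V f g) (orb f g v) \<longleftrightarrow>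
      (k = l \<and> e \<in> matching V f \<and> e \<subseteq> orb f g v) \<or> (k = m \<and> e \<in> matching V g \<and> e \<subseteq> orb f g v)"
    unfolding edges_within_def alt_edges_def by auto
  also have "\<dots> \<longleftrightarrow> (k = l \<and> (\<exists>w\<in>orb f g v. e = {w, f w} \<and> f w \<noteq> w))
      \<or> (k = m \<and> (\<exists>w\<in>orb f g v. e = {w, g w} \<and> g w \<noteq> w))"
    using matching[of f] matching[of g] by (simp add: orb_step)
  finally show ?thesis by blast
qed

text \<open>The walk from \<open>v\<close> never stalls, so by \<open>walk_fold\<close> coincidences
  occur only at even distances. Up to its first return \<open>p\<close> it visits distinct vertices;
  this set is closed under both maps and hence is the whole orbit.\<close>

lemma orbit_is_cycle:
  assumes lm: "l \<noteq> m" and nofix: "\<not> has_fixpoint f g (orb f g v)"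
  shows "is_cycle (orb f g v) (edges_within (alt_edges l m V f g) (orb f g v))"
proof -
  let ?s = "walk f g v"
  have nf: "f w \<noteq> w" "g w \<noteq> w" if "w \<in> orb f g v" for w
    using nofix that by (auto simp: has_fixpoint_def)
  have ns: "?s i \<noteq> ?s (Suc i)" for i
    using nf[OF walk_in_orb[of f g v i]] by auto
  have par: "even (j - i)" if "?s i = ?s j" "i \<le> j" for i j
  proof (rule ccontr)
    assume "odd (j - i)"
    then obtain d where "j - i = 2 * d + 1" by (rule oddE)
    then have "j = i + Suc (2 * d)" using that by simp
    then show False using walk_fold[of i d] that ns by auto
  qed
  have ex: "\<exists>p>0. ?s p = ?s 0"
  proof -
    obtain i j where ij: "i < j" "?s i = ?s j" using walk_repeats by blast
    have "even (j - i)" by (rule par) (use ij in auto)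
    then obtain d where "j - i = 2 * d" by (rule evenE)
    then have "j = i + 2 * d" "d > 0" using ij by auto
    then have "?s 0 = ?s (2 * d)" using walk_unshift[of i d] ij by auto
    then show ?thesis using \<open>d > 0\<close> by (intro exI[of _ "2 * d"]) auto
  qed
  define p where "p = (LEAST p. p > 0 \<and> ?s p = ?s 0)"
  have p: "p > 0" "?s p = ?s 0"
    using LeastI_ex[OF ex] unfolding p_def by auto
  have least: "?s q \<noteq> ?s 0" if "0 < q" "q < p" for q
    using not_less_Least[of q "\<lambda>p. p > 0 \<and> ?s p = ?s 0"] that unfolding p_def by auto
  have evp: "even p" using par[of 0 p] p by simp
  have inj: "i = j" if "?s i = ?s j" "i \<le> j" "j < p" for i j
  proof (rule ccontr)
    assume "i \<noteq> j"
    have "even (j - i)" by (rule par) (use that in auto)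
    then obtain d where "j - i = 2 * d" by (rule evenE)
    then have j: "j = i + 2 * d" "d > 0" using that \<open>i \<noteq> j\<close> by auto
    then have "?s 0 = ?s (2 * d)" using walk_unshift[of i d] that by auto
    then show False using least[of "2 * d"] j that by auto
  qed
  have inj': "i = j" if "?s i = ?s j" "i < p" "j < p" for i j
  proof (cases "i \<le> j")
    case True
    then show ?thesis using inj that by blast
  next
    case False
    then have "j = i" by (intro inj[OF that(1)[symmetric]]) (use that in auto)
    then show ?thesis ..
  qed
  have modp: "?s (Suc i mod p) = ?s (Suc i)" if "i < p" for i
    using that p by (cases "Suc i = p") auto
  \<comment> \<open>Since \<open>p\<close> is even, the step from \<open>p - 1\<close> back to the
    start uses \<open>g\<close>; this edge closes the cycle.\<close>
  have last: "g v = ?s (p - 1)"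
    using walk_back[of "p - 1"] p evp by (cases p) (auto simp del: walk.simps(2))
  have orb: "orb f g v = ?s ` {..<p}"
  proof
    show "?s ` {..<p} \<subseteq> orb f g v" using walk_in_orb by auto
    have step: "f (?s i) \<in> ?s ` {..<p} \<and> g (?s i) \<in> ?s ` {..<p}" if i: "i < p" for i
    proof -
      have succ_in: "?s (Suc i) \<in> ?s ` {..<p}"
        using modp[OF i] p by (metis imageI lessThan_iff mod_less_divisor)
      have prev_in: "(if even i then g else f) (?s i) \<in> ?s ` {..<p}"
      proof (cases i)
        case 0
        then show ?thesis using last p by auto
      next
        case (Suc j)
        then have "(if even i then g else f) (?s i) = ?s j" using walk_back[of j] by auto
        then show ?thesis using i Suc by auto
      qed
      show ?thesis using succ_in prev_in by (auto split: if_splits)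
    qed
    show "orb f g v \<subseteq> ?s ` {..<p}"
      by (rule orb_least) (use p step in force)+
  qed
  define e where "e i = (if even i then l else m, {?s i, ?s (Suc i)})" for i
  \<comment> \<open>Equal labels force equal parity of \<open>i\<close> and \<open>j\<close>. If
    \<open>i\<close> and \<open>j\<close> differ, equal endpoints force
    \<open>i = Suc j mod p\<close>, which has the other parity because \<open>p\<close> is even. For
    \<open>p = 2\<close> it is the labels that separate the two edges.\<close>
  have e_inj: "i = j" if "e i = e j" "i < p" "j < p" for i j
  proof (rule ccontr)
    assume ne: "i \<noteq> j"
    have eo: "even i \<longleftrightarrow> even j" using that(1) lm by (auto simp: e_def split: if_splits)
    have "?s i \<in> {?s j, ?s (Suc j)}" using that(1) by (auto simp: e_def)
    then have "?s i = ?s (Suc j mod p)"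
      using inj'[OF _ that(2,3)] ne modp[OF that(3)] by auto
    then have "i = Suc j mod p" using inj'[of i "Suc j mod p"] that p by auto
    then have "even i \<longleftrightarrow> even (Suc j)" using evp by (metis dvd_mod_iff)
    then show False using eo by simp
  qed
  have e_in: "e i \<in> edges_within (alt_edges l m V f g) (orb f g v)" for i
    unfolding e_def edge_in_orb_iff
    by (rule bexI[of _ "?s i"]) (use ns[of i] walk_in_orb[of f g v i] in \<open>auto split: if_splits\<close>)
  have edge: "x \<in> e ` {..<p}" if x_in: "x \<in> edges_within (alt_edges l m V f g) (orb f g v)" for x
  proof -
    obtain k y where x: "x = (k, y)" by (cases x)
    then obtain w where w: "w \<in> orb f g v"
      "(k = l \<and> y = {w, f w}) \<or> (k = m \<and> y = {w, g w})"
      using x_in unfolding x edge_in_orb_iff by blast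
    then obtain i where i: "i < p" "w = ?s i" using orb by auto
    show ?thesis
    \<comment> \<open>An edge at the vertex number \<open>i\<close> of the walk is the outgoing one,
      \<open>e i\<close>, or else the incoming one, \<open>e (i - 1)\<close>, which for
      \<open>i = 0\<close> wraps around to \<open>e (p - 1)\<close>.\<close>
    proof (cases "x = e i")
      case True
      then show ?thesis using i by auto
    next
      case False
      show ?thesis
      proof (cases i)
        case 0
        then have "x = (m, {v, g v})" using False w x i by (auto simp: e_def)
        also have "\<dots> = e (p - 1)"
          using last p evp by (cases p) (auto simp: e_def simp del: walk.simps(2))
        finally show ?thesis using p by auto
      next
        case (Suc j)
        have "(if even j then f else g) w = ?s j" using walk_back[of j] i Suc by auto
        then have "x = e j"
          using False w x i Suc by (auto simp: e_def split: if_splits)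
        then show ?thesis using i Suc by auto
      qed
    qed
  qed
  show ?thesis
    unfolding is_cycle_def
  proof (intro exI conjI)
    show "map ?s [0..<p] \<noteq> []" using p by simp
    show "distinct (map ?s [0..<p])"
      unfolding distinct_map using inj' by (auto intro!: inj_onI)
    show "set (map ?s [0..<p]) = orb f g v" unfolding orb by auto
    show "distinct (map e [0..<p])"
      unfolding distinct_map using e_inj by (auto intro!: inj_onI)
    show "set (map e [0..<p]) = edges_within (alt_edges l m V f g) (orb f g v)"
      using e_in edge by (auto simp: atLeast0LessThan)
    show "\<forall>i<length (map ?s [0..<p]). snd (map e [0..<p] ! i) =
        {map ?s [0..<p] ! i, map ?s [0..<p] ! (Suc i mod length (map ?s [0..<p]))}"
      using modp p by (auto simp: e_def simp del: walk.simps)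
  qed simp
qed

text \<open>The walk starts at an end, leaves it by \<open>f\<close>, and runs until its first
  stall, which is the other end. Every repetition forces an earlier stall, so the vertices up to
  there are distinct. An isolated vertex is the case of a stall at position 0.\<close>

lemma orbit_is_path_from_end:
  assumes fixed: "g v = v"
  shows "is_path (orb f g v) (edges_within (alt_edges l m V f g) (orb f g v))"
proof -
  let ?s = "walk f g v"
  \<comment> \<open>A return to \<open>v\<close> at an even time arrives by \<open>g\<close>, which
    fixes \<open>v\<close>; so the walk was at \<open>v\<close> already one step before, at an odd
    distance from the start, and \<open>walk_fold\<close> applies.\<close>
  have turn: "\<exists>k. Suc k < q \<and> ?s k = ?s (Suc k)" if q: "?s 0 = ?s q" "even q" "q > 0" for q
  proof -
    obtain k where k: "q = 2 * k" using q(2) by (rule evenE)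
    then obtain d where "k = Suc d" using q(3) by (cases k) auto
    then have d: "q = 2 * Suc d" using k by simp
    have "?s (Suc (2 * d)) = g (?s q)"
      using walk_back[of "Suc (2 * d)"] d by (simp del: walk.simps)
    then have "?s 0 = ?s (0 + Suc (2 * d))" using q fixed by simp
    from walk_fold[OF this] obtain k where "k \<le> 2 * d" "?s k = ?s (Suc k)" by auto
    then show ?thesis using d by (intro exI[of _ k]) auto
  qed
  have turn': "\<exists>k<j. ?s k = ?s (Suc k)" if "?s i = ?s j" "i < j" for i j
  proof (cases "even (j - i)")
    case True
    then obtain d where "j - i = 2 * d" by (rule evenE)
    then have j: "j = i + 2 * d" "d > 0" using that by auto
    then have "?s 0 = ?s (2 * d)" using walk_unshift[of i d] that by auto
    from turn[OF this] obtain k where "Suc k < 2 * d" "?s k = ?s (Suc k)" using j by auto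
    then show ?thesis using j by (intro exI[of _ k]) auto
  next
    case False
    then obtain d where "j - i = 2 * d + 1" by (rule oddE)
    then have "j = i + Suc (2 * d)" using that by simp
    then show ?thesis using walk_fold[of i d] that le_imp_less_Suc by (metis add_Suc_right)
  qed
  have ex: "\<exists>k. ?s k = ?s (Suc k)"
    using walk_repeats turn' by blast
  define n where "n = (LEAST k. ?s k = ?s (Suc k))"
  have n: "?s n = ?s (Suc n)" unfolding n_def using ex by (rule LeastI_ex)
  have least: "?s k \<noteq> ?s (Suc k)" if "k < n" for k
    using not_less_Least that unfolding n_def by blast
  have inj: "i = j" if "?s i = ?s j" "i \<le> j" "j \<le> n" for i j
    using turn'[OF that(1)] that(2,3) least le_neq_implies_less order_less_le_trans by blast
  have inj': "i = j" if "?s i = ?s j" "i \<le> n" "j \<le> n" for i j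
  proof (cases "i \<le> j")
    case True
    then show ?thesis using inj that by blast
  next
    case False
    then have "j = i" by (intro inj[OF that(1)[symmetric]]) (use that in auto)
    then show ?thesis ..
  qed
  have prev: "(if even j then f else g) (?s (Suc j)) = ?s j" for j
    using walk_back[of j] by simp
  have orb: "orb f g v = ?s ` {..n}"
  proof
    show "?s ` {..n} \<subseteq> orb f g v" using walk_in_orb by auto
    have step: "f (?s i) \<in> ?s ` {..n} \<and> g (?s i) \<in> ?s ` {..n}" if i: "i \<le> n" for i
    proof -
      have succ_in: "?s (Suc i) \<in> ?s ` {..n}"
      proof (cases "i = n")
        case True
        then show ?thesis using n by (metis imageI atMost_iff order_refl)
      next
        case False
        then show ?thesis using i by (intro imageI) auto
      qed
      have prev_in: "(if even i then g else f) (?s i) \<in> ?s ` {..n}"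
      proof (cases i)
        case 0
        then show ?thesis using fixed by force
      next
        case (Suc j)
        then have "(if even i then g else f) (?s i) = ?s j" using prev[of j] by auto
        then show ?thesis using i Suc by auto
      qed
      show ?thesis using succ_in prev_in by (auto split: if_splits)
    qed
    show "orb f g v \<subseteq> ?s ` {..n}"
      by (rule orb_least) (use step in force)+
  qed
  define e where "e i = (if even i then l else m, {?s i, ?s (Suc i)})" for i
  have e_inj: "i = j" if "e i = e j" "i < n" "j < n" for i j
  proof -
    have "{?s i, ?s (Suc i)} = {?s j, ?s (Suc j)}" using that by (simp add: e_def del: walk.simps)
    then have "(i = j \<or> i = Suc j) \<and> (j = i \<or> j = Suc i)"
      using inj' that
      by (metis Suc_leI doubleton_eq_iff less_imp_le)
    then show ?thesis by auto
  qed
  have e_in: "e i \<in> edges_within (alt_edges l m V f g) (orb f g v)" if "i < n" for i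
    unfolding e_def edge_in_orb_iff
    by (rule bexI[of _ "?s i"])
       (use least[OF that] walk_in_orb[of f g v i] in \<open>auto split: if_splits\<close>)
  have edge: "x \<in> e ` {..<n}" if x_in: "x \<in> edges_within (alt_edges l m V f g) (orb f g v)" for x
  proof -
    obtain k y where x: "x = (k, y)" by (cases x)
    then obtain w where w: "w \<in> orb f g v"
      "(k = l \<and> y = {w, f w} \<and> f w \<noteq> w) \<or> (k = m \<and> y = {w, g w} \<and> g w \<noteq> w)"
      using x_in unfolding x edge_in_orb_iff by blast
    then obtain i where i: "i \<le> n" "w = ?s i" using orb by auto
    show ?thesis
    proof (cases "x = e i \<and> i < n")
      case True
      then show ?thesis by auto
    next
      case False
      \<comment> \<open>If \<open>x\<close> were the outgoing edge at position \<open>i\<close>, it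
        would be \<open>e i\<close> with \<open>i < n\<close>, since the walk stalls at
        \<open>n\<close>. So \<open>x\<close> is the incoming edge, which at \<open>i = 0\<close>
        would be a loop at the fixed point of \<open>g\<close> and is excluded.\<close>
      have other: "x = (if even i then m else l, {w, (if even i then g else f) w})
          \<and> (if even i then g else f) w \<noteq> w"
      proof -
        have "\<not> (x = (if even i then l else m, {w, (if even i then f else g) w})
            \<and> (if even i then f else g) w \<noteq> w)"
        proof
          assume *: "x = (if even i then l else m, {w, (if even i then f else g) w})
            \<and> (if even i then f else g) w \<noteq> w"
          then have "x = e i" by (simp add: e_def i(2))
          moreover have "i \<noteq> n" using * n i(2) by (metis walk.simps(2))
          ultimately show False using False i(1) by simp
        qed
        then show ?thesis using w(2) unfolding x by (cases "even i") (simp_all, blast+)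
      qed
      show ?thesis
      proof (cases i)
        case 0
        then show ?thesis using other i fixed by auto
      next
        case (Suc j)
        have "x = e j" using other prev[of j] i Suc by (auto simp: e_def)
        then show ?thesis using i Suc by auto
      qed
    qed
  qed
  show ?thesis
    unfolding is_path_def
  proof (intro exI conjI)
    show "distinct (map ?s [0..<Suc n])"
      unfolding distinct_map using inj' by (auto intro!: inj_onI simp del: upt_Suc)
    show "set (map ?s [0..<Suc n]) = orb f g v"
      unfolding orb by (simp del: upt_Suc add: lessThan_Suc_atMost atLeast0LessThan)
    show "distinct (map e [0..<n])"
      unfolding distinct_map using e_inj by (auto intro!: inj_onI)
    show "set (map e [0..<n]) = edges_within (alt_edges l m V f g) (orb f g v)"
      using e_in edge by (auto simp: atLeast0LessThan)
    show "\<forall>i<length (map e [0..<n]). snd (map e [0..<n] ! i) =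
        {map ?s [0..<Suc n] ! i, map ?s [0..<Suc n] ! Suc i}"
      by (auto simp: e_def simp del: walk.simps upt_Suc)
  qed simp
qed

end

text \<open>The walk is restarted at a fixed point of the orbit; if this point is fixed by
  \<open>f\<close> rather than \<open>g\<close>, the two maps and their labels change roles.\<close>

lemma orbit_is_path:
  assumes inv: "involutions V f g" and v: "v \<in> V" and "has_fixpoint f g (orb f g v)"
  shows "is_path (orb f g v) (edges_within (alt_edges l m V f g) (orb f g v))"
proof -
  obtain w where w: "w \<in> orb f g v" "f w = w \<or> g w = w"
    using assms by (auto simp: has_fixpoint_def)
  have wV: "w \<in> V" using orb_subset[OF inv v] w by auto
  have orb: "orb f g v = orb f g w" by (rule orb_eq[OF inv v w(1), symmetric])
  show ?thesis
  proof (cases "g w = w")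
    case True
    then show ?thesis unfolding orb by (rule orbit_is_path_from_end[OF inv wV])
  next
    case False
    then have "f w = w" using w by simp
    then show ?thesis
      unfolding orb unfolding orb_commute[of f g] alt_edges_commute[of l m V f g]
      by (rule orbit_is_path_from_end[OF inv[unfolded involutions_commute[of V f g]] wV])
  qed
qed

text \<open>A cycle has as many edges as vertices, a path one fewer. This makes the classification
  of orbits exclusive.\<close>

lemma not_cycle_and_path: "\<not> (is_cycle V E \<and> is_path V E)"
proof -
  have "card V = card E" if "is_cycle V E"
    using that unfolding is_cycle_def by (auto simp: distinct_card)
  moreover have "card V = Suc (card E)" if "is_path V E"
    using that unfolding is_path_def by (auto simp: distinct_card)
  ultimately show ?thesis by auto
qed

lemma index_eq_orbit_index:
  assumes inv: "involutions V f g" and "l \<noteq> m"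
  defines "E \<equiv> alt_edges l m V f g"
  shows "2 * card {C \<in> components V E. is_cycle C (edges_within E C)}
       + card {C \<in> components V E. is_path C (edges_within E C)} = orbit_index V f g"
proof -
  have comp: "components V E = orb f g ` V"
    unfolding E_def by (rule components_alt_edges[OF inv])
  have fin: "finite (components V E)"
    using inv by (simp add: comp involutions_def)
  have weight: "(is_path C (edges_within E C) \<longleftrightarrow> has_fixpoint f g C)
      \<and> (is_cycle C (edges_within E C) \<longleftrightarrow> \<not> has_fixpoint f g C)" if C: "C \<in> components V E" for C
  proof -
    obtain v where v: "v \<in> V" "C = orb f g v" using C unfolding comp by blast
    show ?thesis
    proof (cases "has_fixpoint f g C")
      case True
      then have "is_path C (edges_within E C)"
        using orbit_is_path[OF inv v(1)] unfolding E_def v(2) by simp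
      then show ?thesis using True not_cycle_and_path by blast
    next
      case False
      then have "is_cycle C (edges_within E C)"
        using orbit_is_cycle[OF inv v(1) \<open>l \<noteq> m\<close>] unfolding E_def v(2) by simp
      then show ?thesis using False not_cycle_and_path by blast
    qed
  qed
  have "orbit_index V f g = (\<Sum>C\<in>components V E.
      (if is_path C (edges_within E C) then 1 else 0) + (if is_cycle C (edges_within E C) then 2 else 0))"
    unfolding orbit_index_def comp[symmetric] by (intro sum.cong) (auto simp: weight)
  also have "\<dots> = card {C \<in> components V E. is_path C (edges_within E C)}
      + 2 * card {C \<in> components V E. is_cycle C (edges_within E C)}"
    unfolding sum.distrib using fin
    by (simp add: sum.inter_filter[symmetric])
  finally show ?thesis by simp
qed

section \<open>The index of a meander\<close>

text \<open>Reversal of each block. It is meaningful only on \<open>{1..sum_list c}\<close>; at 0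
  the truncated subtraction gives spurious values. The middle of an odd block is a fixed point, that
  is, a vertex without an arc on this side.\<close>

fun flip :: "nat list \<Rightarrow> nat \<Rightarrow> nat" where
  "flip [] v = v"
| "flip (a # c) v = (if v \<in> {1..a} then a + 1 - v else a + flip c (v - a))"

lemma flip_in: "v \<in> {1..sum_list c} \<Longrightarrow> flip c v \<in> {1..sum_list c}"
proof (induction c arbitrary: v)
  case (Cons a c)
  show ?case
  proof (cases "v \<le> a")
    case True
    then show ?thesis using Cons.prems by auto
  next
    case False
    then have "v - a \<in> {1..sum_list c}" using Cons.prems by auto
    from Cons.IH[OF this] False show ?thesis by auto
  qed
qed simp

lemma flip_flip: "v \<in> {1..sum_list c} \<Longrightarrow> flip c (flip c v) = v"
proof (induction c arbitrary: v)
  case (Cons a c)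
  show ?case
  proof (cases "v \<le> a")
    case True
    then show ?thesis using Cons.prems by auto
  next
    case False
    then have "v - a \<in> {1..sum_list c}" using Cons.prems by auto
    from Cons.IH[OF this] flip_in[OF this] False show ?thesis by auto
  qed
qed simp

lemma involutions_flip:
  "sum_list us = n \<Longrightarrow> sum_list ls = n \<Longrightarrow> involutions {1..n} (flip us) (flip ls)"
  unfolding involutions_def
  by (intro conjI ballI) (use flip_in[of _ us] flip_in[of _ ls] in \<open>simp_all add: flip_flip\<close>)

lemma arcs_Nil: "arcs [] = {}"
  unfolding arcs_def by simp

lemma arcs_memI:
  assumes "j < length c" "1 \<le> i" "i \<le> c ! j div 2"
  shows "{sum_list (take j c) + i, sum_list (take j c) + c ! j + 1 - i} \<in> arcs c"
  unfolding arcs_def using assms by blast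

text \<open>Turns the positional description of the arcs into a recursion parallel to that of
  \<open>flip\<close>: first block, then a shifted copy of the rest.\<close>

lemma arcs_Cons:
  "arcs (a # c) = {{i, a + 1 - i} | i. 1 \<le> i \<and> i \<le> a div 2} \<union> (\<lambda>e. (+) a ` e) ` arcs c"
  (is "?L = ?A \<union> ?B")
proof (intro equalityI subsetI)
  fix e assume "e \<in> ?L"
  then obtain j i where j: "j < length (a # c)" "1 \<le> i" "i \<le> (a # c) ! j div 2"
    "e = {sum_list (take j (a # c)) + i, sum_list (take j (a # c)) + (a # c) ! j + 1 - i}"
    unfolding arcs_def by blast
  show "e \<in> ?A \<union> ?B"
  proof (cases j)
    case 0
    then show ?thesis using j by auto
  next
    case (Suc k)
    let ?e = "{sum_list (take k c) + i, sum_list (take k c) + c ! k + 1 - i}"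
    have "?e \<in> arcs c" by (rule arcs_memI) (use j Suc in auto)
    moreover have "e = (+) a ` ?e" using j Suc by auto
    ultimately show ?thesis by blast
  qed
next
  fix e assume "e \<in> ?A \<union> ?B"
  then show "e \<in> ?L"
  proof
    assume "e \<in> ?A"
    then obtain i where "1 \<le> i" "i \<le> a div 2" "e = {i, a + 1 - i}" by blast
    then show ?thesis using arcs_memI[of 0 "a # c" i] by simp
  next
    assume "e \<in> ?B"
    then obtain j i where j: "j < length c" "1 \<le> i" "i \<le> c ! j div 2"
      "e = (+) a ` {sum_list (take j c) + i, sum_list (take j c) + c ! j + 1 - i}"
      unfolding arcs_def by blast
    then have "e = {sum_list (take (Suc j) (a # c)) + i, sum_list (take (Suc j) (a # c)) + (a # c) ! Suc j + 1 - i}"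
      by auto
    then show ?thesis using arcs_memI[of "Suc j" "a # c" i] j by simp
  qed
qed

lemma arcs_eq_matching: "arcs c = matching {1..sum_list c} (flip c)"
proof (induction c)
  case Nil
  then show ?case by (simp add: arcs_Nil matching_def)
next
  case (Cons a c)
  let ?M = "matching {1..sum_list (a # c)} (flip (a # c))"
  \<comment> \<open>The arcs are indexed by their left endpoints only, the matching by both; a
    vertex in the right half is replaced by its mirror image.\<close>
  have block: "{{i, a + 1 - i} | i. 1 \<le> i \<and> i \<le> a div 2} = {{v, a + 1 - v} | v. v \<in> {1..a} \<and> a + 1 - v \<noteq> v}"
    (is "?A = ?B")
  proof (intro equalityI subsetI)
    fix e assume "e \<in> ?A"
    then obtain i where "1 \<le> i" "i \<le> a div 2" "e = {i, a + 1 - i}" by blast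
    then show "e \<in> ?B" by (intro CollectI exI[of _ i]) auto
  next
    fix e assume "e \<in> ?B"
    then obtain v where v: "v \<in> {1..a}" "a + 1 - v \<noteq> v" "e = {v, a + 1 - v}" by blast
    show "e \<in> ?A"
    proof (cases "v \<le> a div 2")
      case True
      then show ?thesis using v by auto
    next
      case False
      have "e = {a + 1 - v, a + 1 - (a + 1 - v)}" using v by auto
      moreover have "1 \<le> a + 1 - v \<and> a + 1 - v \<le> a div 2" using v False by auto
      ultimately show ?thesis by blast
    qed
  qed
  have split: "{1..sum_list (a # c)} = {1..a} \<union> (+) a ` {1..sum_list c}"
    by (auto simp: image_iff)
  have "?M = {{v, flip (a # c) v} | v. v \<in> {1..a} \<and> flip (a # c) v \<noteq> v}
      \<union> {{v, flip (a # c) v} | v. v \<in> (+) a ` {1..sum_list c} \<and> flip (a # c) v \<noteq> v}"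
    unfolding matching_def split by blast
  also have "{{v, flip (a # c) v} | v. v \<in> {1..a} \<and> flip (a # c) v \<noteq> v} = ?A"
    unfolding block by (intro Collect_cong ex_cong) auto
  also have "{{v, flip (a # c) v} | v. v \<in> (+) a ` {1..sum_list c} \<and> flip (a # c) v \<noteq> v}
      = (\<lambda>e. (+) a ` e) ` matching {1..sum_list c} (flip c)" (is "?C = ?D")
  proof (intro equalityI subsetI)
    fix e assume "e \<in> ?C"
    then obtain v where v: "v \<in> {1..sum_list c}" "e = {a + v, flip (a # c) (a + v)}"
      "flip (a # c) (a + v) \<noteq> a + v" by blast
    then have "e = (+) a ` {v, flip c v}" "flip c v \<noteq> v" by auto
    then show "e \<in> ?D" unfolding matching_def using v by blast
  next
    fix e assume "e \<in> ?D"
    then obtain v where v: "v \<in> {1..sum_list c}" "flip c v \<noteq> v" "e = (+) a ` {v, flip c v}"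
      unfolding matching_def by blast
    then have "e = {a + v, flip (a # c) (a + v)}" "flip (a # c) (a + v) \<noteq> a + v" by auto
    then show "e \<in> ?C" using v by blast
  qed
  finally show ?case unfolding arcs_Cons Cons.IH by simp
qed

lemma ind_eq_orbit_index:
  assumes "sum_list us = n" "sum_list ls = n"
  shows "ind (us, ls) = orbit_index {1..n} (flip us) (flip ls)"
proof -
  have "meander_edges us ls = alt_edges Upper Lower {1..n} (flip us) (flip ls)"
    unfolding meander_edges_def alt_edges_def using assms by (simp add: arcs_eq_matching)
  then show ?thesis
    unfolding ind_def num_cycles_def num_paths_def meander_components_def
    using index_eq_orbit_index[OF involutions_flip[OF assms], of Upper Lower] assms by simp
qed

section \<open>Rules for evaluating the index\<close>

lemma ind_Nil: "ind ([], []) = 0"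
  by (simp add: ind_eq_orbit_index[of _ 0] orbit_index_def)

lemma ind_commute:
  assumes "sum_list us = sum_list ls"
  shows "ind (us, ls) = ind (ls, us)"
  unfolding ind_eq_orbit_index[OF assms refl] ind_eq_orbit_index[OF refl assms]
  by (rule orbit_index_commute)

text \<open>Needed because the reduction leaves the part \<open>b - 2 * a\<close>, which is 0 when
  \<open>b = 2 * a\<close>.\<close>

lemma ind_zero_part: "sum_list us = sum_list ls \<Longrightarrow> ind (0 # us, ls) = ind (us, ls)"
proof -
  have "flip (0 # us) = flip us" by auto
  then show "sum_list us = sum_list ls \<Longrightarrow> ind (0 # us, ls) = ind (us, ls)"
    by (simp add: ind_eq_orbit_index[of _ "sum_list ls"])
qed

text \<open>On the first \<open>a\<close> vertices the two involutions coincide and contribute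
  \<open>a\<close> by \<open>orbit_index_same\<close>; the remaining vertices form a shifted copy of
  the smaller meander.\<close>

lemma ind_cancel:
  assumes sums: "sum_list us = sum_list ls"
  shows "ind (a # us, a # ls) = a + ind (us, ls)"
proof -
  let ?n = "sum_list ls" and ?f = "flip (a # us)" and ?g = "flip (a # ls)"
  let ?W = "{a + 1..a + ?n}"
  have U: "{1..a + ?n} = {1..a} \<union> ?W" by auto
  have inv: "involutions {1..?n} (flip us) (flip ls)"
    by (rule involutions_flip[OF sums refl])
  have inv1: "involutions {1..a} ?f ?f"
    unfolding involutions_def by auto
  have inv1': "involutions {1..a} ?f ?g"
    unfolding involutions_def by auto
  have shift: "?f v = a + flip us (v - a)" "?g v = a + flip ls (v - a)" "v - a \<in> {1..?n}"
    if "v \<in> ?W" for v using that by auto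
  have inv2: "involutions ?W ?f ?g"
    unfolding involutions_def
  proof (intro conjI ballI)
    fix v assume v: "v \<in> ?W"
    note D = involutionsD[OF inv shift(3)[OF v]]
    show "?f v \<in> ?W" "?g v \<in> ?W" "?f (?f v) = v" "?g (?g v) = v"
      using D v unfolding shift(1,2)[OF v] by auto
  qed simp
  have "ind (a # us, a # ls) = orbit_index {1..a + ?n} ?f ?g"
    using sums by (intro ind_eq_orbit_index) auto
  also have "\<dots> = orbit_index {1..a} ?f ?g + orbit_index ?W ?f ?g"
    unfolding U by (rule orbit_index_union[OF inv1' inv2]) auto
  also have "orbit_index {1..a} ?f ?g = orbit_index {1..a} ?f ?f"
    by (rule orbit_index_cong[OF inv1]) auto
  also have "\<dots> = a"
    using orbit_index_same[OF inv1] by simp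
  also have "orbit_index ?W ?f ?g = orbit_index {1..?n} (flip us) (flip ls)"
  proof (rule orbit_index_transfer[OF inv2 inv, where r = "\<lambda>v. v - a" and s = "(+) a"])
    fix v assume v: "v \<in> ?W"
    show "v - a \<in> {1..?n}" "a + (v - a) \<in> orb ?f ?g v"
      using v by auto
    show "?f v - a \<in> orb (flip us) (flip ls) (v - a)" "?g v - a \<in> orb (flip us) (flip ls) (v - a)"
      unfolding shift(1,2)[OF v] by (auto simp: orb_step)
    show "has_fixpoint (flip us) (flip ls) (orb (flip us) (flip ls) (v - a))" if "?f v = v \<or> ?g v = v"
      unfolding has_fixpoint_def
      by (rule bexI[of _ "v - a"]) (use that v in \<open>auto simp: shift(1,2)[OF v] simp del: flip.simps\<close>)
  next
    fix v assume v: "v \<in> {1..?n}"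
    then have aW: "a + v \<in> ?W" by auto
    show "a + v \<in> ?W" by (rule aW)
    show "a + v - a = v" by simp
    have shift': "?f (a + v) = a + flip us v" "?g (a + v) = a + flip ls v"
      using v by auto
    show "a + flip us v \<in> orb ?f ?g (a + v)" "a + flip ls v \<in> orb ?f ?g (a + v)"
      unfolding shift'[symmetric] by (rule orb_step[OF orb_self])+
    show "has_fixpoint ?f ?g (orb ?f ?g (a + v))" if "flip us v = v \<or> flip ls v = v"
      unfolding has_fixpoint_def
      by (rule bexI[of _ "a + v"]) (use that shift' in \<open>auto simp del: flip.simps\<close>)
  qed
  also have "\<dots> = ind (us, ls)"
    by (rule ind_eq_orbit_index[symmetric, OF sums refl])
  finally show ?thesis .
qed

text \<open>As \<open>2 * a \<le> b\<close>, the lower arcs carry \<open>{1..a}\<close> to the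
  disjoint block \<open>{b - a + 1..b}\<close>. Contracting these arcs and shifting by
  \<open>a\<close> removes \<open>{1..a}\<close>; the upper arcs over it reappear as lower arcs over
  \<open>{b - 2 * a + 1..b - a}\<close>, the new part \<open>a\<close>, while the part
  \<open>b - 2 * a\<close> keeps the inner arcs of the old block.\<close>

lemma ind_reduce:
  assumes ab: "2 * a \<le> b" and sums: "a + sum_list us = b + sum_list ls"
  shows "ind (a # us, b # ls) = ind (us, (b - 2 * a) # a # ls)"
proof -
  let ?n = "sum_list us"
  let ?f = "flip (a # us)" and ?g = "flip (b # ls)"
  let ?f' = "flip us" and ?g' = "flip ((b - 2 * a) # a # ls)"
  \<comment> \<open>A vertex of the first block is moved across its lower arc, to
    \<open>b + 1 - v\<close>, before the shift by \<open>a\<close>.\<close>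
  define r where "r v = (if v \<le> a then b + 1 - v - a else v - a)" for v
  have inv: "involutions {1..a + ?n} ?f ?g"
    by (rule involutions_flip) (use sums in auto)
  have inv': "involutions {1..?n} ?f' ?g'"
    by (rule involutions_flip) (use sums ab in auto)
  have bn: "b \<le> a + ?n" using sums by simp
  have f_shift: "?f (a + v) = a + ?f' v" if "v \<ge> 1" for v using that by auto
  have f_low: "?f v = a + 1 - v" if "v \<in> {1..a}" for v using that by auto
  have g_low: "?g v = b + 1 - v" if "v \<in> {1..b}" for v using that by auto
  have g'_out: "a + ?g' v = ?g (a + v)" if "v \<ge> 1" "v \<notin> {b - 2 * a + 1..b - a}" for v
    using that ab by (auto simp: not_le)
  have g'_mid: "?g' v = 2 * (b - a) - a + 1 - v" if "v \<in> {b - 2 * a + 1..b - a}" for v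
    using that ab by auto
  \<comment> \<open>On the new block the reduced lower involution is the conjugate of the upper one:
    across the contracted arc, along the upper arc, and back.\<close>
  have g_mid: "?g (a + v) \<in> {1..a}" "a + ?g' v = ?g (?f (?g (a + v)))"
    if "v \<in> {b - 2 * a + 1..b - a}" for v
  proof -
    have 1: "?g (a + v) = b + 1 - (a + v)" using that ab by (intro g_low) auto
    show 2: "?g (a + v) \<in> {1..a}" unfolding 1 using that ab by auto
    have 3: "?f (?g (a + v)) = a + 1 - (b + 1 - (a + v))" using f_low[OF 2] unfolding 1 .
    have "?g (?f (?g (a + v))) = b + 1 - (a + 1 - (b + 1 - (a + v)))"
      unfolding 3 using that ab by (intro g_low) auto
    then show "a + ?g' v = ?g (?f (?g (a + v)))" unfolding g'_mid[OF that] using that ab by auto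
  qed
  have mid: "r v = ?g v - a" "?g v \<ge> a" "r v \<in> {b - 2 * a + 1..b - a}" "a + r v = ?g v" if "v \<in> {1..a}" for v
    using that ab unfolding r_def by auto
  have r_high: "r v = v - a" "a + r v = v" if "v \<notin> {1..a}" "v \<ge> 1" for v
    using that unfolding r_def by auto
  have s_g': "a + ?g' v \<in> orb ?f ?g (a + v)" if "v \<ge> 1" for v
  proof (cases "v \<in> {b - 2 * a + 1..b - a}")
    case True
    then show ?thesis unfolding g_mid(2)[OF True] by (intro orb_step orb_self)
  next
    case False
    then show ?thesis unfolding g'_out[OF that False] by (intro orb_step orb_self)
  qed
  have sr: "a + r v \<in> orb ?f ?g v" if "v \<ge> 1" for v
  proof (cases "v \<in> {1..a}")
    case True
    then show ?thesis unfolding mid(4)[OF True] by (intro orb_step orb_self)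
  next
    case False
    then show ?thesis unfolding r_high(2)[OF False that] by simp
  qed
  have "ind (a # us, b # ls) = orbit_index {1..a + ?n} ?f ?g"
    by (rule ind_eq_orbit_index) (use sums in auto)
  also have "\<dots> = orbit_index {1..?n} ?f' ?g'"
  proof (rule orbit_index_transfer[OF inv inv', where r = r and s = "(+) a"])
    fix v assume v: "v \<in> {1..a + ?n}"
    then have v1: "v \<ge> 1" by simp
    show rV: "r v \<in> {1..?n}" unfolding r_def using v ab bn by auto
    show "a + r v \<in> orb ?f ?g v" by (rule sr[OF v1])
    \<comment> \<open>Along a contracted arc \<open>r\<close> is constant; along every other lower
      arc it commutes with the lower involution.\<close>
    have g_r: "r (?g v) \<in> orb ?f' ?g' (r v)"
    proof (cases "v \<in> {1..a}")
      case True
      then have "r (?g v) = r v" using mid[OF True] True ab unfolding r_def by auto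
      then show ?thesis by simp
    next
      case False
      note rv = r_high[OF False v1]
      have r1: "r v \<ge> 1" using rV by simp
      show ?thesis
      proof (cases "r v \<in> {b - 2 * a + 1..b - a}")
        case True
        have low: "?g v \<in> {1..a}" using g_mid(1)[OF True] unfolding rv(2) .
        have "r (?g v) = ?g (?g v) - a" by (rule mid(1)[OF low])
        also have "\<dots> = r v" using involutionsD(4)[OF inv v] rv by simp
        finally show ?thesis by simp
      next
        case out: False
        have "?g v = a + ?g' (r v)" using g'_out[OF r1 out] unfolding rv(2) by simp
        moreover have "?g' (r v) \<in> {1..?n}" using involutionsD(2)[OF inv' rV] .
        ultimately have "r (?g v) = ?g' (r v)" unfolding r_def[of "?g v"] by simp
        then show ?thesis by (simp add: orb_step del: flip.simps)
      qed
    qed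
    show "r (?g v) \<in> orb ?f' ?g' (r v)" by (rule g_r)
    have f_mid: "?f v \<in> {1..a}" "r (?f v) = ?g' (r v)" if "v \<in> {1..a}"
    proof -
      show f_in: "?f v \<in> {1..a}" unfolding f_low[OF that] using that by auto
      have "r (?f v) = b + 1 - (a + 1 - v) - a"
        using f_in unfolding f_low[OF that] r_def by simp
      moreover have "r v = b + 1 - v - a" using that unfolding r_def by simp
      moreover have "b + 1 - (a + 1 - v) - a = 2 * (b - a) - a + 1 - (b + 1 - v - a)"
      proof -
        \<comment> \<open>Writing \<open>b\<close> and \<open>a\<close> as sums removes the
          truncated subtractions from the identity.\<close>
        obtain c where "b = 2 * a + c" using ab by (auto simp: le_iff_add)
        moreover have "v \<le> a" using that by simp
        then obtain d where "a = v + d" by (auto simp: le_iff_add)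
        ultimately show ?thesis by simp
      qed
      ultimately show "r (?f v) = ?g' (r v)"
        unfolding g'_mid[OF mid(3)[OF that]] by (simp only:)
    qed
    have f_high: "?f v = a + ?f' (r v)" "r (?f v) = ?f' (r v)" if "v \<notin> {1..a}"
    proof -
      note rv = r_high[OF that v1]
      show 1: "?f v = a + ?f' (r v)" using f_shift[of "r v"] rV unfolding rv(2) by simp
      have "?f' (r v) \<in> {1..?n}" using involutionsD(1)[OF inv' rV] .
      then show "r (?f v) = ?f' (r v)" unfolding 1 r_def[of "a + _"] by simp
    qed
    show "r (?f v) \<in> orb ?f' ?g' (r v)"
      using f_mid(2) f_high(2) orb_step[OF orb_self[of "r v" ?f' ?g']]
      by (cases "v \<in> {1..a}") (simp_all del: flip.simps)
    show "has_fixpoint ?f' ?g' (orb ?f' ?g' (r v))" if fv: "?f v = v \<or> ?g v = v"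
    proof -
      have "?f' (r v) = r v \<or> ?g' (r v) = r v"
      proof (cases "v \<in> {1..a}")
        case True
        \<comment> \<open>The lower involution moves the first block off itself, so the fixed point
          belongs to the upper one and becomes a fixed point of the new lower one.\<close>
        then have "?g v \<noteq> v" using ab by auto
        then show ?thesis using fv f_mid(2)[OF True] by metis
      next
        case False
        note rv = r_high[OF False v1]
        have r1: "r v \<ge> 1" using rV by simp
        show ?thesis
        proof (cases "?f v = v")
          case True
          then show ?thesis using f_high(2)[OF False] by simp
        next
          case nf: False
          then have gv: "?g v = v" using fv by blast
          then have "r v \<notin> {b - 2 * a + 1..b - a}"
            using g_mid(1)[of "r v"] False unfolding rv(2) by metis
          from g'_out[OF r1 this] have "a + ?g' (r v) = a + r v" unfolding rv(2) gv .
          then show ?thesis by (simp del: flip.simps)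
        qed
      qed
      then show ?thesis unfolding has_fixpoint_def by (meson orb_self)
    qed
  next
    fix v assume v: "v \<in> {1..?n}"
    then have v1: "v \<ge> 1" by simp
    show "a + v \<in> {1..a + ?n}" "r (a + v) = v" unfolding r_def using v by auto
    show "a + ?f' v \<in> orb ?f ?g (a + v)"
      unfolding f_shift[OF v1, symmetric] by (intro orb_step orb_self)
    show "a + ?g' v \<in> orb ?f ?g (a + v)" by (rule s_g'[OF v1])
    show "has_fixpoint ?f ?g (orb ?f ?g (a + v))" if fv: "?f' v = v \<or> ?g' v = v"
    proof (cases "?f' v = v")
      case True
      then have "?f (a + v) = a + v" using f_shift[OF v1] by (simp del: flip.simps)
      then show ?thesis unfolding has_fixpoint_def by (meson orb_self)
    next
      case nf: False
      then have gv: "?g' v = v" using fv by blast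
      have av: "a + v \<in> {1..a + ?n}" using v by simp
      show ?thesis
      proof (cases "v \<in> {b - 2 * a + 1..b - a}")
        case True
        \<comment> \<open>A fixed point of the conjugate yields a fixed point of \<open>?f\<close>
          at \<open>?g (a + v)\<close>, in the same orbit.\<close>
        have "a + v = ?g (?f (?g (a + v)))"
          using g_mid(2)[OF True] unfolding gv .
        then have "?g (a + v) = ?g (?g (?f (?g (a + v))))" by (rule arg_cong)
        also have "\<dots> = ?f (?g (a + v))"
          using involutionsD[OF inv] av by blast
        finally have "?f (?g (a + v)) = ?g (a + v)" ..
        moreover have "?g (a + v) \<in> orb ?f ?g (a + v)" by (intro orb_step orb_self)
        ultimately show ?thesis unfolding has_fixpoint_def by blast
      next
        case False
        have "?g (a + v) = a + v" using g'_out[OF v1 False] unfolding gv ..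
        then show ?thesis unfolding has_fixpoint_def by (meson orb_self)
      qed
    qed
  qed
  also have "\<dots> = ind (us, (b - 2 * a) # a # ls)"
    by (rule ind_eq_orbit_index[symmetric]) (use sums ab in auto)
  finally show ?thesis .
qed

section \<open>Generating functions\<close>

text \<open>
  The state of a partially read meander is a pair of prefixes \<open>p\<close>, \<open>q\<close>; \<open>tail_gf J p q\<close> sums over
  all ways to complete it with further parts from \<open>J\<close>, which may exclude the parts of \<open>p\<close> and \<open>q\<close>.
\<close>

definition tails :: "nat set \<Rightarrow> nat list \<Rightarrow> nat list \<Rightarrow> nat \<Rightarrow> (nat list \<times> nat list) set" where
  "tails J p q n = {(us, ls). set us \<subseteq> J \<and> set ls \<subseteq> J \<and>
     sum_list p + sum_list us = n \<and> sum_list q + sum_list ls = n}"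

definition tail_gf :: "nat set \<Rightarrow> nat list \<Rightarrow> nat list \<Rightarrow> rat fps fps" where
  "tail_gf J p q = Abs_fps (\<lambda>n. \<Sum>(us, ls)\<in>tails J p q n. fps_X ^ ind (p @ us, q @ ls))"

lemma tail_gf_nth:
  "tail_gf J p q $ n = (\<Sum>(us, ls)\<in>tails J p q n. fps_X ^ ind (p @ us, q @ ls))"
  by (simp add: tail_gf_def)

lemma length_le_sum_list: "0 \<notin> set us \<Longrightarrow> length us \<le> sum_list us" for us :: "nat list"
  by (induction us) auto

lemma sum_list_eq_0_iff_Nil: "0 \<notin> set us \<Longrightarrow> sum_list us = 0 \<longleftrightarrow> us = []" for us :: "nat list"
  by (cases us) auto

text \<open>Positive parts bound the lengths by \<open>n\<close>. Hence the sums in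
  \<open>tail_gf\<close> are genuine and not the default value 0 of a sum over an infinite
  set.\<close>

lemma finite_tails:
  assumes "finite J" "0 \<notin> J"
  shows "finite (tails J p q n)"
proof (rule finite_subset)
  let ?W = "{us. set us \<subseteq> J \<and> length us \<le> n}"
  show "finite (?W \<times> ?W)" using finite_lists_length_le[OF assms(1)] by simp
  show "tails J p q n \<subseteq> ?W \<times> ?W"
  proof
    fix M assume "M \<in> tails J p q n"
    then obtain us ls where M: "M = (us, ls)" "set us \<subseteq> J" "set ls \<subseteq> J"
      "sum_list us \<le> n" "sum_list ls \<le> n" by (auto simp: tails_def)
    then have "length us \<le> n" "length ls \<le> n"
      using length_le_sum_list[of us] length_le_sum_list[of ls] assms(2) by force+
    then show "M \<in> ?W \<times> ?W" using M by auto
  qed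
qed

lemma tail_gf_commute: "tail_gf J p q = tail_gf J q p"
proof (rule fps_ext)
  fix n
  show "tail_gf J p q $ n = tail_gf J q p $ n"
    unfolding tail_gf_nth
    by (rule sum.reindex_bij_witness[of _ prod.swap prod.swap])
       (auto simp: tails_def intro!: arg_cong[of _ _ "\<lambda>k. fps_X ^ k"] ind_commute)
qed

text \<open>The symmetry oriented for rewriting: a nonempty prefix facing an empty one is moved to
  the upper side.\<close>

lemma tail_gf_Nil_Cons: "tail_gf J [] (a # q) = tail_gf J (a # q) []"
  by (rule tail_gf_commute)

lemma tail_gf_zero_part: "tail_gf J p (0 # q) = tail_gf J p q"
proof (rule fps_ext)
  fix n
  have "tails J p (0 # q) n = tails J p q n" by (simp add: tails_def)
  moreover have "ind (p @ us, 0 # q @ ls) = ind (p @ us, q @ ls)" if "(us, ls) \<in> tails J p q n" for us ls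
  proof -
    have s: "sum_list (p @ us) = sum_list (q @ ls)" using that by (simp add: tails_def)
    then have "ind (p @ us, 0 # q @ ls) = ind (0 # q @ ls, p @ us)" by (intro ind_commute) simp
    also have "\<dots> = ind (q @ ls, p @ us)" by (rule ind_zero_part[OF s[symmetric]])
    also have "\<dots> = ind (p @ us, q @ ls)" by (rule ind_commute[OF s[symmetric]])
    finally show ?thesis .
  qed
  ultimately show "tail_gf J p (0 # q) $ n = tail_gf J p q $ n"
    unfolding tail_gf_nth by (intro sum.cong) auto
qed

text \<open>The \<open>a\<close> cancelled vertices account for \<open>varx ^ a\<close>, and the
  \<open>a\<close> they add to the index for \<open>vary ^ a\<close>.\<close>

lemma tail_gf_cancel: "tail_gf J (a # p) (a # q) = varx ^ a * vary ^ a * tail_gf J p q"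
proof (rule fps_ext)
  fix n
  have "(varx ^ a * vary ^ a * tail_gf J p q) $ n =
      (if n < a then 0 else fps_X ^ a * tail_gf J p q $ (n - a))"
    by (simp add: fps_X_power_mult_nth fps_const_power mult.assoc)
  also have "\<dots> = tail_gf J (a # p) (a # q) $ n"
  proof (cases "n < a")
    case True
    then have "tails J (a # p) (a # q) n = {}" by (auto simp: tails_def)
    then show ?thesis using True by (simp add: tail_gf_nth)
  next
    case False
    then have "tails J (a # p) (a # q) n = tails J p q (n - a)" by (auto simp: tails_def)
    then show ?thesis using False
      unfolding tail_gf_nth
      by (auto simp: sum_distrib_left tails_def ind_cancel power_add intro!: sum.cong)
  qed
  finally show "tail_gf J (a # p) (a # q) $ n = (varx ^ a * vary ^ a * tail_gf J p q) $ n" ..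
qed

text \<open>Contraction loses \<open>a\<close> vertices but no index, hence a power of
  \<open>varx\<close> alone.\<close>

lemma tail_gf_reduce:
  assumes ab: "2 * a \<le> b"
  shows "tail_gf J (a # p) (b # q) = varx ^ a * tail_gf J p ((b - 2 * a) # a # q)"
proof (rule fps_ext)
  fix n
  have "(varx ^ a * tail_gf J p ((b - 2 * a) # a # q)) $ n =
      (if n < a then 0 else tail_gf J p ((b - 2 * a) # a # q) $ (n - a))"
    by (simp add: fps_X_power_mult_nth)
  also have "\<dots> = tail_gf J (a # p) (b # q) $ n"
  proof (cases "n < a")
    case True
    then have "tails J (a # p) (b # q) n = {}" by (auto simp: tails_def)
    then show ?thesis using True by (simp add: tail_gf_nth)
  next
    case False
    then have "tails J (a # p) (b # q) n = tails J p ((b - 2 * a) # a # q) (n - a)"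
      using ab by (auto simp: tails_def)
    moreover have "ind (a # p @ us, b # q @ ls) = ind (p @ us, (b - 2 * a) # a # q @ ls)"
      if "(us, ls) \<in> tails J (a # p) (b # q) n" for us ls
      by (rule ind_reduce[OF ab]) (use that in \<open>simp add: tails_def\<close>)
    ultimately show ?thesis using False
      unfolding tail_gf_nth by (auto intro!: sum.cong)
  qed
  finally show "tail_gf J (a # p) (b # q) $ n = (varx ^ a * tail_gf J p ((b - 2 * a) # a # q)) $ n" ..
qed

text \<open>The shorter side must have a further part; the completions are split according to that
  part. Strictness rules out the empty completion of \<open>q\<close>.\<close>

lemma tail_gf_extend:
  assumes J: "finite J" "0 \<notin> J" and pq: "sum_list q < sum_list p"
  shows "tail_gf J p q = (\<Sum>a\<in>J. tail_gf J p (q @ [a]))"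
proof (rule fps_ext)
  fix n
  have "(\<Sum>a\<in>J. tail_gf J p (q @ [a])) $ n =
      (\<Sum>(a, us, ls)\<in>Sigma J (\<lambda>a. tails J p (q @ [a]) n). fps_X ^ ind (p @ us, q @ a # ls))"
    unfolding fps_sum_nth tail_gf_nth
    by (subst sum.Sigma) (use J finite_tails[OF J] in auto)
  also have "\<dots> = tail_gf J p q $ n"
    unfolding tail_gf_nth
  proof (rule sum.reindex_bij_witness[of _ "\<lambda>(us, ls). (hd ls, us, tl ls)" "\<lambda>(a, us, ls). (us, a # ls)"])
    fix M assume M: "M \<in> tails J p q n"
    obtain us ls where "M = (us, ls)" by (cases M)
    then show "(case case M of (us, ls) \<Rightarrow> (hd ls, us, tl ls) of (a, us, ls) \<Rightarrow> (us, a # ls)) = M"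
      "(case M of (us, ls) \<Rightarrow> (hd ls, us, tl ls)) \<in> Sigma J (\<lambda>a. tails J p (q @ [a]) n)"
      using M pq by (cases ls; auto simp: tails_def)+
  qed (auto simp: tails_def)
  finally show "tail_gf J p q $ n = (\<Sum>a\<in>J. tail_gf J p (q @ [a])) $ n" ..
qed

text \<open>The summand 1 is the empty meander; every other one has a first part on each
  side.\<close>

lemma tail_gf_Nil:
  assumes J: "finite J" "0 \<notin> J"
  shows "tail_gf J [] [] = 1 + (\<Sum>a\<in>J. \<Sum>b\<in>J. tail_gf J [a] [b])"
proof (rule fps_ext)
  fix n
  let ?i = "\<lambda>(us, ls). ((hd us, hd ls), tl us, tl ls)"
  let ?j = "\<lambda>((a, b), us, ls). (a # us, b # ls)"
  let ?S = "Sigma (J \<times> J) (\<lambda>(a, b). tails J [a] [b] n)"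
  have "(\<Sum>a\<in>J. \<Sum>b\<in>J. tail_gf J [a] [b]) $ n =
      (\<Sum>((a, b), us, ls)\<in>?S. fps_X ^ ind (a # us, b # ls))"
    unfolding fps_sum_nth tail_gf_nth unfolding sum.cartesian_product
    by (subst sum.Sigma[symmetric]) (use J finite_tails[OF J] in \<open>auto simp: split_def\<close>)
  also have "\<dots> = (\<Sum>(us, ls)\<in>tails J [] [] n - {([], [])}. fps_X ^ ind (us, ls))"
  proof (rule sum.reindex_bij_witness[of _ ?i ?j])
    fix M assume M: "M \<in> tails J [] [] n - {([], [])}"
    obtain us ls where M': "M = (us, ls)" by (cases M)
    have s: "us = [] \<longleftrightarrow> sum_list us = 0" "ls = [] \<longleftrightarrow> sum_list ls = 0"
      using M M' J(2) sum_list_eq_0_iff_Nil[of us] sum_list_eq_0_iff_Nil[of ls]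
      by (auto simp: tails_def)
    then obtain a us' b ls' where "us = a # us'" "ls = b # ls'"
      using M M' by (cases us; cases ls) (auto simp: tails_def)
    then show "?j (?i M) = M" "?i M \<in> ?S"
      using M M' by (auto simp: tails_def)
  qed (auto simp: tails_def)
  finally have sum: "(\<Sum>a\<in>J. \<Sum>b\<in>J. tail_gf J [a] [b]) $ n =
      (\<Sum>(us, ls)\<in>tails J [] [] n - {([], [])}. fps_X ^ ind (us, ls))" .
  have "([], []) \<in> tails J [] [] n \<longleftrightarrow> n = 0" by (auto simp: tails_def)
  then show "tail_gf J [] [] $ n = (1 + (\<Sum>a\<in>J. \<Sum>b\<in>J. tail_gf J [a] [b])) $ n"
    unfolding fps_add_nth sum tail_gf_nth
    using finite_tails[OF J, of "[]" "[]" n]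
    by (cases "n = 0") (simp_all add: sum.remove[of _ "([], [])"] ind_Nil)
qed

section \<open>Meander counts and the linear system for parts 1 and 4\<close>

lemma meander_count_eq:
  assumes "0 \<notin> J"
  shows "meander_count J n k = card {M \<in> tails J [] [] n. ind M = k}"
proof -
  have "{M. is_meander n M \<and> set (fst M) \<subseteq> J \<and> set (snd M) \<subseteq> J \<and> ind M = k}
      = {M \<in> tails J [] [] n. ind M = k}"
    using assms by (auto simp: tails_def is_meander_def is_composition_def intro!: gr0I)
  then show ?thesis by (simp add: meander_count_def)
qed

lemma meander_gf_eq_tail_gf:
  assumes J: "finite J" "0 \<notin> J"
  shows "meander_gf J = tail_gf J [] []"
proof (intro fps_ext)
  fix n k
  let ?T = "tails J [] [] n"
  have "meander_gf J $ n $ k = of_nat (card {M \<in> ?T. ind M = k})"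
    by (simp add: meander_gf_def meander_count_eq[OF J(2)])
  also have "\<dots> = (\<Sum>M\<in>?T. if ind M = k then 1 else 0)"
    using finite_tails[OF J] by (simp add: sum.inter_filter[symmetric])
  also have "\<dots> = tail_gf J [] [] $ n $ k"
    unfolding tail_gf_nth fps_sum_nth by (intro sum.cong) auto
  finally show "meander_gf J $ n $ k = tail_gf J [] [] $ n $ k" .
qed

text \<open>Reading the next part on the shorter side and simplifying by the index rules leads back
  to the states \<open>[]\<close>, \<open>[1]\<close>, \<open>[1, 1]\<close>, \<open>[2, 1]\<close>.
  \<open>G0\<close> to \<open>G3\<close> are the resulting linear equations; the factor 2 in
  \<open>G0\<close> comes from the first parts 1 over 4 and 4 over 1.\<close>

lemma meander_gf_1_4:
  "meander_gf {1, 4} =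
      (1 - varx^2 - varx^4 - varx^3 * vary + varx^6) /
      ((1 - varx * vary - varx^4 * vary^4) * (1 - varx^2 - varx^4 - varx^3 * vary + varx^6)
        - 2 * varx^4 * vary * (varx + vary - varx^3))"
proof -
  let ?G = "tail_gf {1, 4}"
  have J: "finite {1, 4 :: nat}" "0 \<notin> {1, 4 :: nat}" by auto
  have extend: "?G p [] = ?G p [1] + ?G p [4]" if "sum_list p > 0" for p
    using tail_gf_extend[OF J, of "[]" p] that by simp
  have G0: "?G [] [] = 1 + varx * vary * ?G [] [] + varx^4 * vary^4 * ?G [] [] + 2 * varx * ?G [2, 1] []"
  proof -
    have "?G [1] [4] = varx * ?G [2, 1] []"
      using tail_gf_reduce[of 1 4 "{1, 4}" "[]" "[]"] by (simp add: tail_gf_Nil_Cons)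
    then show ?thesis
      using tail_gf_Nil[OF J] tail_gf_commute[of "{1, 4}" "[4]" "[1]"]
      by (simp add: tail_gf_cancel algebra_simps)
  qed
  have G1: "?G [1] [] = varx * vary * ?G [] [] + varx * ?G [2, 1] []"
    using extend[of "[1]"] tail_gf_reduce[of 1 4 "{1, 4}" "[]" "[]"]
    by (simp add: tail_gf_cancel tail_gf_Nil_Cons)
  have G2: "?G [1, 1] [] = varx * vary * ?G [1] [] + varx^2 * ?G [1, 1] []"
  proof -
    have "?G [1, 1] [4] = varx^2 * ?G [] [1, 1]"
      using tail_gf_reduce[of 1 4 "{1, 4}" "[1]" "[]"] tail_gf_reduce[of 1 2 "{1, 4}" "[]" "[1]"]
      by (simp add: tail_gf_zero_part power2_eq_square mult.assoc)
    then show ?thesis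
      using extend[of "[1, 1]"] by (simp add: tail_gf_cancel tail_gf_Nil_Cons)
  qed
  have G3: "?G [2, 1] [] = varx * ?G [1, 1] [] + varx^3 * ?G [1] []"
  proof -
    have "?G [1] [2, 1] = varx * ?G [] [1, 1]"
      using tail_gf_reduce[of 1 2 "{1, 4}" "[]" "[1]"] by (simp add: tail_gf_zero_part)
    moreover have "?G [2, 1] [4] = varx^2 * (varx * ?G [] [1])"
      using tail_gf_reduce[of 2 4 "{1, 4}" "[1]" "[]"] tail_gf_reduce[of 1 2 "{1, 4}" "[]" "[]"]
      by (simp add: tail_gf_zero_part)
    moreover have "varx^2 * (varx * F) = varx^3 * F" for F :: "rat fps fps"
      by (simp add: power2_eq_square power3_eq_cube mult.assoc)
    ultimately show ?thesis
      using extend[of "[2, 1]"] tail_gf_commute[of "{1, 4}" "[2, 1]" "[1]"]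
      by (simp add: tail_gf_Nil_Cons)
  qed
  \<comment> \<open>\<open>D\<close> is the determinant of \<open>G1\<close>, \<open>G2\<close>,
    \<open>G3\<close> in the three nonempty states, with the empty state as a parameter. Cramer's
    rule gives the next identity, and inserting it into \<open>G0\<close> gives the
    fraction.\<close>
  define D where "D = 1 - varx^2 - varx^4 - varx^3 * vary + varx^6"
  have "?G [2, 1] [] * D = varx^3 * vary * (varx + vary - varx^3) * ?G [] []"
    using G1 G2 G3 unfolding D_def by algebra
  then have "D = ?G [] [] * ((1 - varx * vary - varx^4 * vary^4) * D
      - 2 * varx^4 * vary * (varx + vary - varx^3))"
    using G0 by algebra
  then show ?thesis
    unfolding D_def meander_gf_eq_tail_gf[OF J]
    by (subst eq_commute, subst fps2_divide_eq_iff) simp_all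
qed

section \<open>Scaling all parts by c\<close>

context
  fixes c :: nat and us ls :: "nat list"
begin

text \<open>In these rules the digits name the prefix above and the part below in units of
  \<open>c\<close>. The sides are exchanged so that the longer prefix is again on top.\<close>

lemma ind_reduce_1_2:
  assumes "c + sum_list us = 2 * c + sum_list ls"
  shows "ind (c # us, 2 * c # ls) = ind (c # ls, us)"
proof -
  have "ind (c # us, 2 * c # ls) = ind (us, 0 # c # ls)"
    using ind_reduce[of c "2 * c" us ls] assms by simp
  also have "\<dots> = ind (0 # c # ls, us)" by (rule ind_commute) (use assms in simp)
  also have "\<dots> = ind (c # ls, us)" by (rule ind_zero_part) (use assms in simp)
  finally show ?thesis .
qed

lemma ind_reduce_1_4:
  assumes "c + sum_list us = 4 * c + sum_list ls"
  shows "ind (c # us, 4 * c # ls) = ind (2 * c # c # ls, us)"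
proof -
  have "ind (c # us, 4 * c # ls) = ind (us, 2 * c # c # ls)"
    using ind_reduce[of c "4 * c" us ls] assms by simp
  also have "\<dots> = ind (2 * c # c # ls, us)" by (rule ind_commute) (use assms in simp)
  finally show ?thesis .
qed

end

context
  fixes c :: nat and us ls :: "nat list"
begin

text \<open>Two reductions in a row: the first leaves \<open>2 * c\<close> below the second
  \<open>c\<close>. The new context lets the previous rules be instantiated at other lists.\<close>

lemma ind_reduce_11_4:
  assumes "2 * c + sum_list us = 4 * c + sum_list ls"
  shows "ind (c # c # us, 4 * c # ls) = ind (c # c # ls, us)"
proof -
  have "ind (c # c # us, 4 * c # ls) = ind (2 * c # c # ls, c # us)"
    by (rule ind_reduce_1_4) (use assms in simp)
  also have "\<dots> = ind (c # us, 2 * c # c # ls)" by (rule ind_commute) (use assms in simp)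
  also have "\<dots> = ind (c # c # ls, us)" by (rule ind_reduce_1_2) (use assms in simp)
  finally show ?thesis .
qed

lemma ind_reduce_21_1:
  assumes "3 * c + sum_list us = c + sum_list ls"
  shows "ind (2 * c # c # us, c # ls) = ind (c # c # us, ls)"
proof -
  have "ind (2 * c # c # us, c # ls) = ind (c # ls, 2 * c # c # us)"
    by (rule ind_commute) (use assms in simp)
  also have "\<dots> = ind (c # c # us, ls)" by (rule ind_reduce_1_2) (use assms in simp)
  finally show ?thesis .
qed

lemma ind_reduce_21_4:
  assumes "3 * c + sum_list us = 4 * c + sum_list ls"
  shows "ind (2 * c # c # us, 4 * c # ls) = ind (c # ls, us)"
proof -
  have "ind (2 * c # c # us, 4 * c # ls) = ind (c # us, 0 # 2 * c # ls)"
    using ind_reduce[of "2 * c" "4 * c" "c # us" ls] assms by simp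
  also have "\<dots> = ind (0 # 2 * c # ls, c # us)" by (rule ind_commute) (use assms in simp)
  also have "\<dots> = ind (2 * c # ls, c # us)" by (rule ind_zero_part) (use assms in simp)
  also have "\<dots> = ind (c # us, 2 * c # ls)" by (rule ind_commute) (use assms in simp)
  also have "\<dots> = ind (c # ls, us)" by (rule ind_reduce_1_2) (use assms in simp)
  finally show ?thesis .
qed

end

text \<open>Induction on the number of unread parts: each rule consumes at least one of them and
  ends in one of the four states. The same rule applies to the scaled and to the original meander;
  only cancellation adds to the index, by \<open>c\<close> times as much in the scaled one.\<close>

lemma ind_scale_aux:
  assumes "set us \<subseteq> {1, 4}" "set ls \<subseteq> {1, 4}" "p \<in> {[], [1], [1, 1], [2, 1]}"
    and "sum_list p + sum_list us = sum_list ls"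
  shows "ind (map ((*) c) (p @ us), map ((*) c) ls) = c * ind (p @ us, ls)"
  using assms
proof (induction "length us + length ls" arbitrary: us ls p rule: less_induct)
  case less
  let ?m = "map ((*) c)"
  have sm: "sum_list (?m xs) = c * sum_list xs" for xs
    by (simp add: sum_list_const_mult)
  \<comment> \<open>The side condition of the scaled rules, in the form in which they ask for
    it.\<close>
  have csums: "c * sum_list p + c * sum_list us = c * sum_list ls"
    by (simp add: less.prems(4) flip: distrib_left)
  show ?case
  proof (cases ls)
    case Nil
    then have "p = []" "sum_list us = 0"
      using less.prems(3,4) by auto
    moreover have "0 \<notin> set us" using less.prems(1) by auto
    ultimately have "us = []" using sum_list_eq_0_iff_Nil[of us] by blast
    then show ?thesis using Nil \<open>p = []\<close> by (simp add: ind_Nil)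
  next
    case (Cons b ls')
    then have ls': "set ls' \<subseteq> {1, 4}" and b: "b = 1 \<or> b = 4" using less.prems(2) by auto
    have IH: "ind (?m (q @ xs), ?m ys) = c * ind (q @ xs, ys)"
      if "length xs + length ys < length us + length ls" "set xs \<subseteq> {1, 4}" "set ys \<subseteq> {1, 4}"
        "q \<in> {[], [1], [1, 1], [2, 1]}" "sum_list q + sum_list xs = sum_list ys" for q xs ys
      using less.hyps[OF that] .
    consider (0) "p = []" | (1) "p = [1]" | (2) "p = [1, 1]" | (3) "p = [2, 1]"
      using less.prems(3) by blast
    then show ?thesis
    proof cases
      case 0
      then obtain a us' where us: "us = a # us'" using less.prems(4) Cons b by (cases us) auto
      then have us': "set us' \<subseteq> {1, 4}" and a: "a = 1 \<or> a = 4" using less.prems(1) by auto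
      consider "a = b" | "a = 1" "b = 4" | "a = 4" "b = 1" using a b by auto
      then show ?thesis
      proof cases
        case 1
        then show ?thesis
          using IH[of us' ls' "[]"] us us' ls' less.prems(4) Cons 0
          by (simp add: ind_cancel sm distrib_left)
      next
        case 2
        then show ?thesis
          using IH[of ls' us' "[2, 1]"] us us' ls' less.prems(4) csums Cons 0
            ind_reduce_1_4[of c "?m us'" "?m ls'"] ind_reduce_1_4[of 1 us' ls']
          by (simp add: sm algebra_simps flip: numeral_2_eq_2)
      next
        case 3
        \<comment> \<open>The reduction rule expects the smaller part on top, so the sides are
          exchanged first.\<close>
        have "ind (?m us, ?m ls) = ind (?m ls, ?m us)" "ind (us, ls) = ind (ls, us)"
          using less.prems(4) 0 by (simp_all add: ind_commute sm)
        then show ?thesis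
          using 3 IH[of us' ls' "[2, 1]"] us us' ls' less.prems(4) csums Cons 0
            ind_reduce_1_4[of c "?m ls'" "?m us'"] ind_reduce_1_4[of 1 ls' us']
          by (simp add: sm algebra_simps flip: numeral_2_eq_2)
      qed
    next
      case 1
      show ?thesis
      proof (cases "b = 1")
        case True
        then show ?thesis
          using IH[of us ls' "[]"] less.prems ls' Cons 1
          by (simp add: ind_cancel sm distrib_left)
      next
        case False
        then show ?thesis
          using b IH[of ls' us "[2, 1]"] less.prems csums ls' Cons 1
            ind_reduce_1_4[of c "?m us" "?m ls'"] ind_reduce_1_4[of 1 us ls']
          by (simp add: sm algebra_simps flip: numeral_2_eq_2)
      qed
    next
      case 2
      show ?thesis
      proof (cases "b = 1")
        case True
        then show ?thesis
          using IH[of us ls' "[1]"] less.prems csums ls' Cons 2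
            ind_cancel[of "c # ?m us" "?m ls'" c] ind_cancel[of "1 # us" ls' 1]
          by (simp add: sm algebra_simps)
      next
        case False
        then show ?thesis
          using b IH[of ls' us "[1, 1]"] less.prems csums ls' Cons 2
            ind_reduce_11_4[of c "?m us" "?m ls'"] ind_reduce_11_4[of 1 us ls']
          by (simp add: sm algebra_simps flip: numeral_2_eq_2)
      qed
    next
      case 3
      show ?thesis
      proof (cases "b = 1")
        case True
        then show ?thesis
          using IH[of us ls' "[1, 1]"] less.prems csums ls' Cons 3
            ind_reduce_21_1[of c "?m us" "?m ls'"] ind_reduce_21_1[of 1 us ls']
          by (simp add: sm algebra_simps flip: numeral_2_eq_2)
      next
        case False
        then show ?thesis
          using b IH[of ls' us "[1]"] less.prems csums ls' Cons 3
            ind_reduce_21_4[of c "?m us" "?m ls'"] ind_reduce_21_4[of 1 us ls']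
          by (simp add: sm algebra_simps flip: numeral_2_eq_2)
      qed
    qed
  qed
qed

lemma ind_scale:
  assumes "set us \<subseteq> {1, 4}" "set ls \<subseteq> {1, 4}" "sum_list us = sum_list ls"
  shows "ind (map ((*) c) us, map ((*) c) ls) = c * ind (us, ls)"
  using ind_scale_aux[of us ls "[]" c] assms by simp

lemma set_subset_scaled_words:
  fixes c :: nat
  assumes "set xs \<subseteq> {c, 4 * c}"
  shows "\<exists>ys. xs = map ((*) c) ys \<and> set ys \<subseteq> {1, 4}"
  using assms
proof (induction xs)
  case (Cons x xs)
  then obtain ys where ys: "xs = map ((*) c) ys" "set ys \<subseteq> {1, 4}" by auto
  have "x = c * 1 \<or> x = c * 4" using Cons.prems by auto
  then obtain d where "x = c * d" "d \<in> {1, 4}" by blast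
  then show ?case using ys by (intro exI[of _ "d # ys"]) auto
qed simp

text \<open>Scaling every part is a bijection between the two kinds of meanders and multiplies both
  the number of nodes and the index by \<open>c\<close>.\<close>

lemma meander_count_scale:
  assumes c: "c \<ge> 1"
  shows "meander_count {c, 4 * c} n k =
    (if c dvd n \<and> c dvd k then meander_count {1, 4} (n div c) (k div c) else 0)"
proof -
  let ?m = "map ((*) c)"
  let ?A = "{M \<in> tails {c, 4 * c} [] [] n. ind M = k}"
  \<comment> \<open>The existential over \<open>n'\<close> treats all \<open>n\<close> and
    \<open>k\<close> at once: the set is empty unless \<open>c\<close> divides both.\<close>
  let ?B = "{M. \<exists>n'. n = c * n' \<and> M \<in> tails {1, 4} [] [] n' \<and> k = c * ind M}"
  have sm: "sum_list (?m xs) = c * sum_list xs" for xs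
    by (simp add: sum_list_const_mult)
  have A: "?A = map_prod ?m ?m ` ?B"
  proof (intro equalityI subsetI)
    fix M assume M: "M \<in> ?A"
    obtain us ls where us: "fst M = ?m us" "set us \<subseteq> {1, 4}" and ls: "snd M = ?m ls" "set ls \<subseteq> {1, 4}"
      using M set_subset_scaled_words[of "fst M" c] set_subset_scaled_words[of "snd M" c]
      unfolding tails_def by fastforce
    have M_eq: "M = (?m us, ?m ls)" using us ls by (simp add: prod_eq_iff)
    have n: "n = c * sum_list us" "n = c * sum_list ls" using M by (auto simp: sm M_eq tails_def)
    then have s: "sum_list us = sum_list ls" using c by auto
    have "k = c * ind (us, ls)"
      using M ind_scale[OF us(2) ls(2) s, of c] by (simp add: M_eq)
    then have "(us, ls) \<in> ?B" using n s us ls by (auto simp: tails_def)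
    moreover have "M = map_prod ?m ?m (us, ls)" by (simp add: M_eq)
    ultimately show "M \<in> map_prod ?m ?m ` ?B" by blast
  next
    fix M assume "M \<in> map_prod ?m ?m ` ?B"
    then obtain us ls where B: "(us, ls) \<in> ?B" and M: "M = (?m us, ?m ls)" by auto
    then have "set us \<subseteq> {1, 4}" "set ls \<subseteq> {1, 4}" "sum_list us = sum_list ls"
      by (auto simp: tails_def)
    from ind_scale[OF this, of c] B show "M \<in> ?A"
      unfolding M by (auto simp: tails_def sm)
  qed
  have "inj_on (map_prod ?m ?m) ?B"
    using c by (auto simp: inj_on_def)
  then have "meander_count {c, 4 * c} n k = card ?B"
    using c unfolding A[symmetric] by (simp add: meander_count_eq A card_image)
  also have "\<dots> = (if c dvd n \<and> c dvd k then meander_count {1, 4} (n div c) (k div c) else 0)"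
  proof (cases "c dvd n \<and> c dvd k")
    case True
    then have "?B = {M \<in> tails {1, 4} [] [] (n div c). ind M = k div c}" using c by auto
    then show ?thesis using True by (simp add: meander_count_eq)
  next
    case False
    then have "?B = {}" by auto
    then have "card ?B = 0" by (simp only: card.empty)
    then show ?thesis using False by auto
  qed
  finally show ?thesis .
qed

lemma meander_gf_scale:
  assumes "c \<ge> 1"
  shows "meander_gf {c, 4 * c} = subst_powers c (meander_gf {1, 4})"
proof (intro fps_ext)
  fix n k
  show "meander_gf {c, 4 * c} $ n $ k = subst_powers c (meander_gf {1, 4}) $ n $ k"
    by (auto simp: meander_gf_def subst_powers_def fps_nth_compose_X_power meander_count_scale[OF assms])
qed

theorem theorem3p7:
  shows "meander_gf {1, 4} =
      (1 - varx^2 - varx^4 - varx^3 * vary + varx^6) /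
      ((1 - varx * vary - varx^4 * vary^4) * (1 - varx^2 - varx^4 - varx^3 * vary + varx^6)
        - 2 * varx^4 * vary * (varx + vary - varx^3))
    \<and> (\<forall>c::nat. c \<ge> 1 \<longrightarrow> meander_gf {c, 4 * c} = subst_powers c (meander_gf {1, 4}))"
  using meander_gf_1_4 meander_gf_scale by blast

end
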